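(* Let $G$ be a compact group and let $\mu=(\mu_k)_{k\in-\mathbf N}$ be a sequence of Borel probability measures on $G$. Then the action $(T_g : g\in G)$ restricted to the set $\mathrm{ex}(\mathcal P_\mu)$ of extremal points of $\mathcal P_\mu$ is transitive: if $\mathbf P^1$ and $\mathbf P^2$ are two solutions in $\mathrm{ex}(\mathcal P_\mu)$, then there exists an element $g\in G$ such that $\mathbf P^1=T_g(\mathbf P^2)$.
   Context: $-\mathbf N=\{0,-1,-2,\dots\}$. On $G^{-\mathbf N}$ let $\eta=(\eta_k)_{k\in-\mathbf N}$ be the coordinate process, and set $\xi_k=(\eta_{k-1})^{-1}\cdot\eta_k$ for $k\in-\mathbf N$. Let $\mathcal F^\eta_k=\sigma(\eta_k,\eta_{k-1},\dots)$. A solution (of the equation $\eta_k=\eta_{k-1}\cdot\xi_k$, $k\in-\mathbf N$, with noise law $\mu$) is a probability measure $\mathbf P$ on $G^{-\mathbf N}$ such that, for every $k\in-\mathbf N$, under $\mathbf P$: (i) $\xi_k$ is independent of $\mathcal F^\eta_{k-1}$; (ii) $\xi_k$ has law $\mu_k$. The set of all solutions is denoted $\mathcal P_\mu$; it is a convex set, and $\mathrm{ex}(\mathcal P_\mu)$ denotes its set of extremal points. For $g\in G$ and $\mathbf P\in\mathcal P_\mu$, $T_g(\mathbf P)(\cdot)=\mathbf P(g\cdot\eta\in\cdot)$, where $g\cdot\eta=(g\cdot\eta_k)_{k\in-\mathbf N}$; this defines a group action of $G$ on $\mathcal P_\mu$ which leaves $\mathrm{ex}(\mathcal P_\mu)$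 invariant.
   Formalization: Solutions are taken to be Borel probability measures on G^{-N} that are inner regular for compact sets, and G is Hausdorff; regularity is automatic if G is second countable, and without it the claim fails, e.g. for G={0,1}^{ω_1} with all μ_k the Dirac mass at the identity. *)

theory Defs
  imports "HOL-Probability.Probability"
begin

text \<open>
  Groups are written additively: \<open>topological_group_add\<close> does not assume commutativity, so
  \<open>x + y\<close> stands for $x \cdot y$ and \<open>- x\<close> for $x^{-1}$.

  The index set $-\mathbf N = \{0,-1,-2,\dots\}$ is encoded by \<open>nat\<close>, with \<open>n\<close> standing for the
  time $k = -n$.  Thus \<open>Suc n\<close> is the time \<^emph>\<open>before\<close> \<open>n\<close>, and the past of time $-n$ consists of
  the coordinates with index \<open>j \<ge> n\<close>.
\<close>

text \<open>
  Path space carries the product topology, and probability measures on it are Borel probability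
  measures that are inner regular for compact sets, as is usual on compact spaces.
  If the group is second countable, the Borel sets of path space are the product
  \<open>\<sigma>\<close>-algebra and regularity is automatic (lemma \<open>radon_prob_path_iff\<close> below).
  For a non-metrizable group the product \<open>\<sigma>\<close>-algebra does not make the increments measurable,
  and regularity cannot be dropped: with all noise laws the Dirac mass at the neutral element,
  the solutions are the images of Borel probability measures on the group under
  $x \mapsto (x, x, \dots)$, and on a group containing the ordinal space $[0,\omega_1]$ as a
  closed subspace the Dieudonne measure would give an extremal solution that is not a
  translate of the one given by the Dirac mass at the neutral element.
\<close>

definition radon_prob :: "'a::topological_space measure \<Rightarrow> bool" where
  "radon_prob P \<longleftrightarrow> prob_space P \<and> sets P = sets borel \<and>
     (\<forall>A\<in>sets borel. emeasure P A = (SUP K\<in>{K. K \<subseteq> A \<and> compact K}. emeasure P K))"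

definition increment :: "nat \<Rightarrow> (nat \<Rightarrow> 'g::group_add) \<Rightarrow> 'g" where
  "increment n \<eta> = - \<eta> (Suc n) + \<eta> n"

definition past :: "nat \<Rightarrow> (nat \<Rightarrow> 'g::topological_space) measure" where
  "past n = sigma UNIV (\<Union>j\<in>{n..}. {(\<lambda>\<eta>. \<eta> j) -` A | A. A \<in> sets borel})"

definition solutions ::
  "(nat \<Rightarrow> 'g::topological_group_add measure) \<Rightarrow> (nat \<Rightarrow> 'g) measure set" where
  "solutions \<mu> = {P. radon_prob P \<and>
     (\<forall>n. prob_space.indep_set P (sets (vimage_algebra UNIV (increment n) borel))
                                 (sets (past (Suc n))) \<and>
          distr P borel (increment n) = \<mu> n)}"

definition extremal :: "'a measure set \<Rightarrow> 'a measure set" where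
  "extremal S = {P \<in> S. \<not> (\<exists>Q\<in>S. \<exists>R\<in>S. Q \<noteq> R \<and> (\<exists>t. 0 < t \<and> t < 1 \<and>
     (\<forall>A\<in>sets P. measure P A = t * measure Q A + (1 - t) * measure R A)))}"

definition translate ::
  "'g::topological_group_add \<Rightarrow> (nat \<Rightarrow> 'g) measure \<Rightarrow> (nat \<Rightarrow> 'g) measure" where
  "translate g P = distr P borel (\<lambda>\<eta> n. g + \<eta> n)"


lemma open_sigma_compact:
  fixes U :: "'a::second_countable_topology set"
  assumes H: "Hausdorff_space (euclidean :: 'a topology)"
    and c: "compact (UNIV :: 'a set)" and U: "open U"
  shows "\<exists>K :: nat \<Rightarrow> 'a set. (\<forall>n. compact (K n)) \<and> U = (\<Union>n. K n)"
proof -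
  obtain B :: "'a set set" where B: "countable B" "topological_basis B"
    using ex_countable_basis by blast
  define C where "C = insert {} (closure ` {V\<in>B. closure V \<subseteq> U})"
  have cC: "countable C" "C \<noteq> {}" using B(1) by (auto simp: C_def)
  have "U = \<Union>C"
  proof
    show "\<Union>C \<subseteq> U" by (auto simp: C_def)
    show "U \<subseteq> \<Union>C"
    proof
      fix x assume x: "x \<in> U"
      have "compact (- U)" using compact_Int_closed[OF c, of "- U"] U by auto
      then have cU: "compactin (euclidean :: 'a topology) (- U)" by (simp add: compactin_euclidean_iff)
      have "\<exists>V W. open V \<and> open W \<and> {x} \<subseteq> V \<and> - U \<subseteq> W \<and> disjnt V W"
        using Hausdorff_space_compact_separation[OF H _ cU, of "{x}"] x
        unfolding open_openin[symmetric] by (metis ComplD compactin_sing disjnt_insert1 disjnt_empty1 UNIV_I topspace_euclidean)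
      then obtain V W where VW: "open V" "open W" "x \<in> V" "- U \<subseteq> W" "V \<inter> W = {}"
        unfolding disjnt_def by (elim exE conjE) simp
      obtain V' where V': "V' \<in> B" "x \<in> V'" "V' \<subseteq> V"
        using topological_basisE[OF B(2) VW(1,3)] by blast
      have "closure V' \<subseteq> - W" using VW V' by (intro closure_minimal) auto
      then have "closure V' \<subseteq> U" using VW by auto
      moreover have "x \<in> closure V'" using V' closure_subset by blast
      ultimately show "x \<in> \<Union>C" using V' by (auto simp: C_def)
    qed
  qed
  moreover have "compact k" if "k \<in> C" for k
    using that compact_Int_closed[OF c, of k] by (auto simp: C_def)
  ultimately show ?thesis
    using cC by (intro exI[of _ "from_nat_into C"]) (auto simp: from_nat_into range_from_nat_into)
qed

lemma radon_prob_iff: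
  fixes P :: "'a::second_countable_topology measure"
  assumes H: "Hausdorff_space (euclidean :: 'a topology)"
    and c: "compact (UNIV :: 'a set)"
  shows "radon_prob P \<longleftrightarrow> prob_space P \<and> sets P = sets borel"
proof
  assume asm: "prob_space P \<and> sets P = sets borel"
  then interpret prob_space P by simp
  have s: "sets P = sets borel" using asm by simp
  then have sp: "space P = UNIV" using sets_eq_imp_space_eq by force
  have cl: "compact k \<longleftrightarrow> closed k" for k :: "'a set"
    using compact_Int_closed[OF c, of k] compactin_imp_closedin[OF H, of k] by auto
  have bm: "A \<in> sets P" if "open A \<or> closed A" for A
    using that unfolding s by (metis borel_open borel_closed)
  define Q where "Q A \<longleftrightarrow> (\<forall>e>0. \<exists>K U. closed K \<and> open U \<and> K \<subseteq> A \<and> A \<subseteq> U \<and> measure P (U - K) < e)"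
    for A
  have QE: "\<exists>K U. closed K \<and> open U \<and> K \<subseteq> A \<and> A \<subseteq> U \<and> measure P (U - K) < e" if "Q A" "e > 0" for A e
    using that unfolding Q_def by simp
  have Q: "Q A" if A: "A \<in> sigma_sets UNIV {S :: 'a set. open S}" for A
    using A
  proof (induction rule: sigma_sets.induct)
    case (Basic U)
    then have oU: "open U" by simp
    obtain K where K: "\<And>n. compact (K n)" "U = (\<Union>n::nat. K n)"
      using open_sigma_compact[OF H c oU] by blast
    define L where "L n = (\<Union>i\<le>n. K i)" for n
    have L: "closed (L n)" "L n \<subseteq> U" for n
      using K cl by (auto simp: L_def)
    have "(\<lambda>n. measure P (L n)) \<longlonglongrightarrow> measure P (\<Union>n. L n)"
      by (rule finite_Lim_measure_incseq) (use L bm in \<open>auto simp: incseq_def L_def\<close>, force)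
    moreover have "(\<Union>n. L n) = U" using K by (auto simp: L_def)
    ultimately have lim: "(\<lambda>n. measure P (L n)) \<longlonglongrightarrow> measure P U" by simp
    show ?case unfolding Q_def
    proof (intro allI impI)
      fix e :: real assume "e > 0"
      then obtain n where "dist (measure P (L n)) (measure P U) < e"
        using metric_LIMSEQ_D[OF lim] by blast
      then have "measure P (U - L n) < e"
        using finite_measure_Diff[of U "L n"] L[of n] bm oU by (auto simp: dist_real_def)
      then show "\<exists>K V. closed K \<and> open V \<and> K \<subseteq> U \<and> U \<subseteq> V \<and> measure P (V - K) < e"
        using L oU by blast
    qed
  next
    case Empty
    show ?case unfolding Q_def by (intro allI impI exI[of _ "{}"]) auto
  next
    case (Compl A)
    show ?case unfolding Q_def
    proof (intro allI impI)
      fix e :: real assume e: "e > 0"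
      obtain K U
        where KU: "closed K" "open U" "K \<subseteq> A" "A \<subseteq> U" "measure P (U - K) < e"
        using QE[OF Compl.IH e] by (elim exE conjE)
      have "- K - (- U) = U - K" by blast
      then have "measure P (- K - (- U)) < e" using KU by metis
      moreover have "closed (- U)" "open (- K)" using KU by auto
      moreover have "- U \<subseteq> UNIV - A" "UNIV - A \<subseteq> - K" using KU by blast+
      ultimately show "\<exists>K V. closed K \<and> open V \<and> K \<subseteq> UNIV - A \<and> UNIV - A \<subseteq> V \<and> measure P (V - K) < e"
        by metis
    qed
  next
    case (Union A)
    show ?case unfolding Q_def
    proof (intro allI impI)
      fix e :: real assume e: "e > 0"
      have "\<forall>n. \<exists>K U. closed K \<and> open U \<and> K \<subseteq> A n \<and> A n \<subseteq> U \<and> measure P (U - K) < e/2 * (1/2)^Suc n"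
        by (intro allI QE[OF Union.IH]) (use e in simp)
      then obtain K U where KU: "\<And>n. closed (K n)" "\<And>n. open (U n)" "\<And>n. K n \<subseteq> A n"
        "\<And>n. A n \<subseteq> U n" "\<And>n. measure P (U n - K n) < e/2 * (1/2)^Suc n"
        by metis
      define L where "L n = (\<Union>i\<le>n. K i)" for n
      have L: "closed (L n)" for n using KU by (auto simp: L_def)
      have UL: "(\<Union>n. L n) = (\<Union>n. K n)" by (auto simp: L_def)
      have "(\<lambda>n. measure P (L n)) \<longlonglongrightarrow> measure P (\<Union>n. L n)"
        by (rule finite_Lim_measure_incseq) (use L bm in \<open>auto simp: incseq_def L_def\<close>, force)
      then obtain n where n: "dist (measure P (L n)) (measure P (\<Union>n. K n)) < e/2"
        using metric_LIMSEQ_D[of _ _ "e/2"] e UL by fastforce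
      have KS: "(\<Union>n. K n) \<in> sets P" using bm KU by blast
      have US: "(\<Union>n. U n) \<in> sets P" using bm KU by blast
      have "L n \<subseteq> (\<Union>n. K n)" by (auto simp: L_def)
      then have 1: "measure P ((\<Union>n. K n) - L n) < e/2"
        using n finite_measure_Diff[OF KS bm[OF disjI2[OF L]] \<open>L n \<subseteq> _\<close>]
        unfolding dist_real_def by linarith
      have sums: "(\<lambda>n. e/2 * (1/2)^Suc n) sums (e/2)"
        using sums_mult[OF power_half_series, of "e/2"] by simp
      have sm: "summable (\<lambda>n. measure P (U n - K n))"
        by (rule summable_comparison_test[OF _ sums_summable[OF sums]])
          (use KU in \<open>auto intro!: exI[of _ 0] less_imp_le\<close>)
      have "measure P ((\<Union>n. U n) - (\<Union>n. K n)) \<le> measure P (\<Union>n. U n - K n)"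
        by (intro finite_measure_mono) (use KU bm in auto)
      also have "\<dots> \<le> (\<Sum>n. measure P (U n - K n))"
        by (intro finite_measure_subadditive_countably sm) (use KU bm in auto)
      also have "\<dots> \<le> e/2"
        using suminf_le[OF less_imp_le[OF KU(5)] sm sums_summable[OF sums]] sums_unique[OF sums]
        by simp
      finally have 2: "measure P ((\<Union>n. U n) - (\<Union>n. K n)) \<le> e/2" .
      have "measure P ((\<Union>n. U n) - L n)
          \<le> measure P (((\<Union>n. U n) - (\<Union>n. K n)) \<union> ((\<Union>n. K n) - L n))"
        by (intro finite_measure_mono) (use KS US bm L in auto)
      also have "\<dots> \<le> measure P ((\<Union>n. U n) - (\<Union>n. K n)) + measure P ((\<Union>n. K n) - L n)"
        by (intro measure_Un_le) (use KS US bm L in auto)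
      finally have "measure P ((\<Union>n. U n) - L n) < e" using 1 2 by simp
      moreover have "L n \<subseteq> \<Union>(range A)" using KU by (force simp: L_def)
      moreover have "\<Union>(range A) \<subseteq> (\<Union>n. U n)" by (intro UN_mono subset_refl KU(4))
      moreover have "open (\<Union>n. U n)" by (intro open_UN ballI KU(2))
      ultimately show "\<exists>K V. closed K \<and> open V \<and> K \<subseteq> \<Union>(range A) \<and> \<Union>(range A) \<subseteq> V \<and> measure P (V - K) < e"
        using L[of n] by metis
    qed
  qed
  have "emeasure P A = (SUP K\<in>{K. K \<subseteq> A \<and> compact K}. emeasure P K)"
    if A: "A \<in> sets borel" for A
  proof (rule ennreal_approx_SUP)
    show "emeasure P K \<le> emeasure P A" if "K \<in> {K. K \<subseteq> A \<and> compact K}" for K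
      using that A s by (auto intro: emeasure_mono)
    show "\<exists>K\<in>{K. K \<subseteq> A \<and> compact K}. emeasure P A \<le> emeasure P K + ennreal e" if e: "e > 0" for e
    proof -
      have "Q A" using Q A unfolding borel_def by simp
      then obtain K U where KU: "closed K" "open U" "K \<subseteq> A" "A \<subseteq> U" "measure P (U - K) < e"
        using QE[OF \<open>Q A\<close> e] by (elim exE conjE)
      have "measure P A \<le> measure P (K \<union> (U - K))"
        by (intro finite_measure_mono) (use KU bm in auto)
      also have "\<dots> \<le> measure P K + measure P (U - K)"
        by (intro measure_Un_le) (use KU bm in auto)
      also have "\<dots> \<le> measure P K + e" using KU by simp
      finally have "emeasure P A \<le> emeasure P K + ennreal e"
        using e by (simp add: emeasure_eq_measure flip: ennreal_plus)
      then show ?thesis using KU cl by auto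
    qed
  qed
  with asm show "radon_prob P" by (simp add: radon_prob_def)
qed (simp add: radon_prob_def)

lemma radon_prob_path_iff:
  fixes P :: "(nat \<Rightarrow> 'g::{t2_space, second_countable_topology}) measure"
  assumes "compact (UNIV :: 'g set)"
  shows "radon_prob P \<longleftrightarrow> prob_space P \<and> sets P = sets (\<Pi>\<^sub>M n\<in>UNIV. borel)"
proof -
  have "compact (UNIV :: (nat \<Rightarrow> 'g) set)"
  proof -
    have "compact_space (product_topology (\<lambda>_::nat. euclidean :: 'g topology) UNIV)"
      using assms unfolding compact_space_product_topology
      by (simp add: compact_space_def)
    then show ?thesis
      unfolding euclidean_product_topology by (simp add: compact_space_def)
  qed
  moreover have "Hausdorff_space (euclidean :: (nat \<Rightarrow> 'g) topology)"
  proof -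
    have "Hausdorff_space (euclidean :: 'g topology)"
      unfolding Hausdorff_space_def using hausdorff by (auto simp: disjnt_def)
    then have "Hausdorff_space (product_topology (\<lambda>_::nat. euclidean :: 'g topology) UNIV)"
      unfolding Hausdorff_space_product_topology by simp
    then show ?thesis
      unfolding euclidean_product_topology .
  qed
  ultimately show ?thesis unfolding sets_PiM_equal_borel by (intro radon_prob_iff)
qed

end

theory Submission
  imports Defs
begin

text \<open>
  Two solutions driven by the same noise differ by a left translation that does not depend on
  time: if \<open>\<omega> n = \<omega> (Suc n) + \<xi> n\<close> and \<open>\<eta> n = \<eta> (Suc n) + \<xi> n\<close>, then
  \<open>\<omega> n - \<eta> n = \<omega> (Suc n) - \<eta> (Suc n)\<close>.  So if extremal solutions \<open>P1\<close> and \<open>P2\<close> can be coupled with a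
  common noise that is independent of their joint past, then \<open>\<omega> = Z + \<eta>\<close> for a random element \<open>Z\<close>
  of the group.  Conditioned on any event of \<open>Z\<close>, the law of \<open>\<eta>\<close> is still a solution, because
  \<open>Z\<close> belongs to the past of every time; extremality of \<open>P2\<close> then forces this conditional law to be \<open>P2\<close>,
  and likewise the conditional law of \<open>\<omega>\<close> is \<open>P1\<close>.  Conditioning on smaller and smaller
  neighbourhoods of a point \<open>z\<close> of the support of \<open>Z\<close> yields \<open>P1 = translate z P2\<close>.

  Such a coupling is only needed in the limit, and its joint law is never constructed.  Take \<open>\<omega>\<close> and \<open>\<eta>\<close>
  independent, with laws \<open>P1\<close> and \<open>P2\<close>, and put \<open>Z n = \<omega> n - \<eta> n\<close>.  From time \<open>-n\<close> on, the path
  \<open>Z n + \<eta>\<close> starts where \<open>\<omega>\<close> does and is driven by the noise of \<open>\<eta>\<close>, hence together with \<open>Z n\<close> it has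
  the same law there as \<open>\<omega>\<close> (lemma \<open>tensor_common_noise\<close>).  By Tychonoff's theorem there is one
  filter of times along which \<open>E[\<phi> (Z n); \<eta> \<in> B]\<close> and \<open>E[\<phi> (Z n); \<omega> \<in> B]\<close> converge for all Borel sets \<open>B\<close>
  and all continuous \<open>\<phi>\<close> with values in the unit interval.  For fixed \<open>\<phi>\<close> the limits are finitely additive in \<open>B\<close> and
  dominated by \<open>P2\<close> and \<open>P1\<close>, and this domination alone makes them countably additive and
  inner regular.  They inherit the
  independence of noise and past, so extremality makes them multiples of \<open>P2\<close> and \<open>P1\<close> (lemma
  \<open>extremal_dominated\<close>, collected in \<open>coupling_limit\<close>).  The point \<open>z\<close> comes from
  \<open>charged_point_exists\<close>, and \<open>coupled_integrals_close\<close> is the comparison of \<open>\<omega>\<close> with \<open>z + \<eta>\<close> near it.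

  The group need not be metrizable, so the difference map need not be measurable for the product of the
  Borel \<open>\<sigma>\<close>-algebras.  Continuous real functions of it are, by the
  Stone-Weierstrass theorem (lemma \<open>borel_measurable_pair_continuous\<close>), which is why events of \<open>Z n\<close>
  are replaced by continuous weights \<open>\<phi> (Z n)\<close> throughout.
\<close>

section \<open>Continuous functions on path space\<close>

lemma open_coordinate_vimage:
  fixes W :: "'b::topological_space set"
  assumes "open W"
  shows "open ((\<lambda>h :: 'a \<Rightarrow> 'b. h i) -` W)"
  by (rule open_vimage[OF assms]) simp

text \<open>
  The lower separation classes are instantiated for functions as well because the type system
  requires the arities of a class and its superclasses to have compatible argument sorts.
\<close>

instance "fun" :: (type, t0_space) t0_space
proof
  fix f g :: "'a \<Rightarrow> 'b" assume "f \<noteq> g"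
  then obtain i where "f i \<noteq> g i" by auto
  then obtain U where "open U" "\<not> (f i \<in> U \<longleftrightarrow> g i \<in> U)" using t0_space_class.t0_space[of "f i" "g i"] by blast
  then show "\<exists>U. open U \<and> \<not> (f \<in> U \<longleftrightarrow> g \<in> U)"
    by (intro exI[of _ "(\<lambda>h. h i) -` U"]) (simp add: open_coordinate_vimage)
qed

instance "fun" :: (type, t1_space) t1_space
proof
  fix f g :: "'a \<Rightarrow> 'b" assume "f \<noteq> g"
  then obtain i where "f i \<noteq> g i" by auto
  then obtain U where "open U" "f i \<in> U" "g i \<notin> U" using t1_space_class.t1_space[of "f i" "g i"] by blast
  then show "\<exists>U. open U \<and> f \<in> U \<and> g \<notin> U"
    by (intro exI[of _ "(\<lambda>h. h i) -` U"]) (simp add: open_coordinate_vimage)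
qed

instance "fun" :: (type, t2_space) t2_space
proof
  fix f g :: "'a \<Rightarrow> 'b" assume "f \<noteq> g"
  then obtain i where "f i \<noteq> g i" by auto
  then obtain U V where "open U" "open V" "f i \<in> U" "g i \<in> V" "U \<inter> V = {}"
    using hausdorff[of "f i" "g i"] by blast
  then show "\<exists>U V. open U \<and> open V \<and> f \<in> U \<and> g \<in> V \<and> U \<inter> V = {}"
    by (intro exI[of _ "(\<lambda>h. h i) -` U"] exI[of _ "(\<lambda>h. h i) -` V"])
      (auto simp: open_coordinate_vimage)
qed

lemma compact_UNIV_fun:
  assumes "compact (UNIV :: 'b::topological_space set)"
  shows "compact (UNIV :: ('a \<Rightarrow> 'b) set)"
proof -
  have "compact_space (product_topology (\<lambda>_::'a. euclidean :: 'b topology) UNIV)"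
    using assms unfolding compact_space_product_topology by (simp add: compact_space_def)
  then show ?thesis
    unfolding euclidean_product_topology by (simp add: compact_space_def)
qed

lemma bounded_continuous_compact:
  fixes f :: "'a::topological_space \<Rightarrow> real"
  assumes "compact (UNIV :: 'a set)" "continuous_on UNIV f"
  obtains C where "0 \<le> C" "\<And>x. \<bar>f x\<bar> \<le> C"
proof -
  have "bounded (range f)"
    by (intro compact_imp_bounded compact_continuous_image assms)
  then obtain C where "\<And>x. \<bar>f x\<bar> \<le> C" by (auto simp: bounded_iff)
  then show ?thesis using that[of "\<bar>C\<bar>"] by (meson abs_ge_self abs_ge_zero order_trans)
qed

lemma Urysohn_compact:
  fixes A B :: "'a::t2_space set"
  assumes "compact (UNIV :: 'a set)" "closed A" "closed B" "A \<inter> B = {}"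
  obtains f :: "'a \<Rightarrow> real" where "continuous_on UNIV f" "\<And>x. 0 \<le> f x" "\<And>x. f x \<le> 1"
    "\<And>x. x \<in> A \<Longrightarrow> f x = 1" "\<And>x. x \<in> B \<Longrightarrow> f x = 0"
proof -
  have "Hausdorff_space (euclidean :: 'a topology)"
    unfolding Hausdorff_space_def using hausdorff by (auto simp: disjnt_def)
  moreover have "compact_space (euclidean :: 'a topology)"
    using assms by (simp add: compact_space_def)
  ultimately have n: "normal_space (euclidean :: 'a topology)"
    using compact_Hausdorff_or_regular_imp_normal_space by blast
  obtain f where f: "continuous_map euclidean (top_of_set {0..1::real}) f"
    "f ` B \<subseteq> {0}" "f ` A \<subseteq> {1}"
    using Urysohn_lemma[OF n, of B A 0 1] assms by (auto simp: disjnt_def)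
  show ?thesis
  proof (rule that)
    show "continuous_on UNIV f" using f(1) by (simp add: continuous_map_in_subtopology)
    have "f x \<in> {0..1}" for x using f(1) by (auto simp: continuous_map_in_subtopology)
    then show "0 \<le> f x" "f x \<le> 1" for x by auto
  qed (use f in auto)
qed

text \<open>
  A cluster point of the sequence of functions \<open>\<lambda>i. a i n\<close> in a Tychonoff cube.  The index set may be uncountable,
  so no subsequence need work for all \<open>i\<close>; a finer filter does.
\<close>

lemma common_convergent_subfilter:
  fixes a :: "'i \<Rightarrow> nat \<Rightarrow> real"
  assumes "\<And>i n. 0 \<le> a i n" "\<And>i n. a i n \<le> 1"
  obtains F l where "F \<noteq> bot" "F \<le> sequentially" "\<And>i. (a i \<longlongrightarrow> l i) F"
proof -
  define x where "x n = (\<lambda>i. a i n)" for n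
  have "compact (Pi\<^sub>E UNIV (\<lambda>_::'i. {0..1::real}))"
  proof -
    have "compactin (product_topology (\<lambda>_::'i. euclidean :: real topology) UNIV)
        (Pi\<^sub>E UNIV (\<lambda>_. {0..1::real}))"
      by (subst compactin_PiE) auto
    then show ?thesis by (simp add: euclidean_product_topology)
  qed
  moreover have "filtermap x sequentially \<noteq> bot" by (simp add: filtermap_bot_iff)
  moreover have "eventually (\<lambda>y. y \<in> Pi\<^sub>E UNIV (\<lambda>_::'i. {0..1::real})) (filtermap x sequentially)"
    using assms by (simp add: eventually_filtermap x_def PiE_def)
  ultimately obtain l where l: "inf (nhds l) (filtermap x sequentially) \<noteq> bot"
    unfolding compact_filter by metis
  define F where "F = inf sequentially (filtercomap x (nhds l))"
  show ?thesis
  proof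
    show "F \<noteq> bot"
    proof
      assume "F = bot"
      then obtain P Q where "eventually P sequentially" "eventually Q (filtercomap x (nhds l))"
        "\<And>n. \<not> (P n \<and> Q n)"
        unfolding F_def trivial_limit_def eventually_inf by blast
      moreover then obtain R where R: "eventually R (nhds l)" "\<And>n. R (x n) \<Longrightarrow> Q n"
        unfolding eventually_filtercomap by blast
      ultimately have "eventually (\<lambda>n. \<not> R (x n)) sequentially"
        by (auto elim!: eventually_mono)
      then have "eventually (\<lambda>y. \<not> R y) (filtermap x sequentially)"
        by (simp add: eventually_filtermap)
      with R(1) have "eventually (\<lambda>_. False) (inf (nhds l) (filtermap x sequentially))"
        unfolding eventually_inf by blast
      with l show False by (simp add: trivial_limit_def)
    qed
    show "F \<le> sequentially" by (simp add: F_def)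
    have "filterlim x (nhds l) F"
      unfolding F_def by (rule filterlim_mono[OF filterlim_filtercomap]) auto
    then show "(a i \<longlongrightarrow> l i) F" for i
      using continuous_on_tendsto_compose[OF continuous_on_product_coordinates[of i], of x l F]
      by (simp add: x_def)
  qed
qed

section \<open>Radon measures and weak limits\<close>

text \<open>
  By inner regularity the values on compact sets determine such a measure, and the indicator of a
  compact set is squeezed by Urysohn functions that vanish on a compact set filling most of the
  complement.
\<close>

lemma radon_prob_eqI:
  fixes P Q :: "'a::t2_space measure"
  assumes c: "compact (UNIV :: 'a set)" and P: "radon_prob P" and Q: "radon_prob Q"
    and eq: "\<And>f :: 'a \<Rightarrow> real. continuous_on UNIV f \<Longrightarrow> integral\<^sup>L P f = integral\<^sup>L Q f"
  shows "P = Q"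
proof -
  have sP: "sets P = sets borel" and sQ: "sets Q = sets borel"
    using P Q by (auto simp: radon_prob_def)
  interpret P: prob_space P using P by (simp add: radon_prob_def)
  interpret Q: prob_space Q using Q by (simp add: radon_prob_def)
  have spP: "space P = UNIV" and spQ: "space Q = UNIV"
    using sets_eq_imp_space_eq[OF sP] sets_eq_imp_space_eq[OF sQ] by auto
  have K: "measure P K \<le> measure Q K" if K: "compact K" for K
  proof (rule field_le_epsilon)
    fix e :: real assume e: "e > 0"
    have clK: "closed K" using K by (rule compact_imp_closed)
    have "\<exists>L\<in>{L. L \<subseteq> - K \<and> compact L}. emeasure Q (- K) < emeasure Q L + ennreal e"
    proof (rule SUP_approx_ennreal[OF e])
      show "{L. L \<subseteq> - K \<and> compact L} \<noteq> {}" using compact_empty by blast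
      show "emeasure Q (- K) = (SUP L\<in>{L. L \<subseteq> - K \<and> compact L}. emeasure Q L)"
        using Q clK by (simp add: radon_prob_def)
    qed (simp add: Q.emeasure_eq_measure)
    then obtain L where L: "L \<subseteq> - K" "compact L" "emeasure Q (- K) < emeasure Q L + ennreal e"
      by blast
    then have QL: "measure Q (- K) \<le> measure Q L + e"
      using L(3) e by (simp add: Q.emeasure_eq_measure ennreal_less_iff flip: ennreal_plus)
    have clL: "closed L" using L(2) by (rule compact_imp_closed)
    obtain f :: "'a \<Rightarrow> real" where f: "continuous_on UNIV f" "\<And>x. 0 \<le> f x" "\<And>x. f x \<le> 1"
      "\<And>x. x \<in> K \<Longrightarrow> f x = 1" "\<And>x. x \<in> L \<Longrightarrow> f x = 0"
      by (rule Urysohn_compact[OF c clK clL]) (use L(1) in auto)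
    have fP: "integrable P f" and fQ: "integrable Q f"
      using f borel_measurable_continuous_onI[OF f(1)] sP sQ
      by (auto intro!: P.integrable_const_bound[of _ 1] Q.integrable_const_bound[of _ 1]
          cong: measurable_cong_sets)
    have "measure P K = (\<integral>x. indicator K x \<partial>P)" using spP by simp
    also have "\<dots> \<le> (\<integral>x. f x \<partial>P)"
      using f clK sP
      by (intro integral_mono fP integrable_real_indicator)
        (auto simp: P.emeasure_eq_measure split: split_indicator)
    also have "\<dots> = (\<integral>x. f x \<partial>Q)" by (rule eq[OF f(1)])
    also have "\<dots> \<le> (\<integral>x. indicator (- L) x \<partial>Q)"
      using f clL sQ
      by (intro integral_mono fQ integrable_real_indicator)
        (auto simp: Q.emeasure_eq_measure split: split_indicator)
    also have "\<dots> = measure Q (- L)" using spQ by simp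
    also have "\<dots> = 1 - measure Q L"
      using Q.prob_compl[of L] clL sQ spQ by (simp add: Compl_eq_Diff_UNIV)
    also have "\<dots> \<le> 1 - measure Q (- K) + e" using QL by simp
    also have "measure Q (- K) = 1 - measure Q K"
      using Q.prob_compl[of K] clK sQ spQ by (simp add: Compl_eq_Diff_UNIV)
    finally show "measure P K \<le> measure Q K + e" by simp
  qed
  have le: "emeasure P A \<le> emeasure Q A" if A: "A \<in> sets borel" for A
  proof -
    have "emeasure P A = (SUP K\<in>{K. K \<subseteq> A \<and> compact K}. emeasure P K)"
      using P A by (simp add: radon_prob_def)
    also have "\<dots> \<le> (SUP K\<in>{K. K \<subseteq> A \<and> compact K}. emeasure Q K)"
      by (intro SUP_mono) (auto simp: P.emeasure_eq_measure Q.emeasure_eq_measure dest: K)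
    also have "\<dots> = emeasure Q A" using Q A by (simp add: radon_prob_def)
    finally show ?thesis .
  qed
  show ?thesis
  proof (rule measure_eqI)
    fix A assume A: "A \<in> sets P"
    have "measure P A \<le> measure Q A"
      using le[of A] A sP by (simp add: P.emeasure_eq_measure Q.emeasure_eq_measure)
    moreover have "measure P (- A) \<le> measure Q (- A)"
      using le[of "- A"] A sP by (simp add: P.emeasure_eq_measure Q.emeasure_eq_measure)
    ultimately show "emeasure P A = emeasure Q A"
      using P.prob_compl[of A] Q.prob_compl[of A] A sP sQ spP spQ
      by (simp add: P.emeasure_eq_measure Q.emeasure_eq_measure Compl_eq_Diff_UNIV)
  qed (simp add: sP sQ)
qed

lemma radon_prob_distr:
  fixes T :: "'a::topological_space \<Rightarrow> 'b::t2_space"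
  assumes P: "radon_prob P" and T: "continuous_on UNIV T"
  shows "radon_prob (distr P borel T)"
proof -
  have sP: "sets P = sets borel" using P by (simp add: radon_prob_def)
  have spP: "space P = UNIV" using sets_eq_imp_space_eq[OF sP] by simp
  interpret P: prob_space P using P by (simp add: radon_prob_def)
  have TM: "T \<in> measurable P borel"
    using borel_measurable_continuous_onI[OF T] sP by (simp cong: measurable_cong_sets)
  have "emeasure (distr P borel T) A
      = (SUP K\<in>{K. K \<subseteq> A \<and> compact K}. emeasure (distr P borel T) K)"
    if A: "A \<in> sets borel" for A
  proof (rule antisym)
    have "emeasure (distr P borel T) A = emeasure P (T -` A)"
      using A TM spP by (simp add: emeasure_distr)
    also have "\<dots> = (SUP K\<in>{K. K \<subseteq> T -` A \<and> compact K}. emeasure P K)"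
      using P A measurable_sets[OF TM A] spP sP by (simp add: radon_prob_def)
    also have "\<dots> \<le> (SUP K\<in>{K. K \<subseteq> A \<and> compact K}. emeasure (distr P borel T) K)"
    proof (rule SUP_mono, safe)
      fix K assume K: "K \<subseteq> T -` A" "compact K"
      have cTK: "compact (T ` K)"
        using K(2) T by (intro compact_continuous_image) (auto intro: continuous_on_subset)
      then have bTK: "T ` K \<in> sets borel" by (intro borel_closed compact_imp_closed)
      have "emeasure P K \<le> emeasure P (T -` (T ` K))"
        using measurable_sets[OF TM bTK] spP by (intro emeasure_mono) auto
      also have "\<dots> = emeasure (distr P borel T) (T ` K)"
        using bTK TM spP by (simp add: emeasure_distr)
      finally show "\<exists>L\<in>{K. K \<subseteq> A \<and> compact K}. emeasure P K \<le> emeasure (distr P borel T) L"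
        using K cTK by (intro bexI[of _ "T ` K"]) auto
    qed
    finally show "emeasure (distr P borel T) A
        \<le> (SUP K\<in>{K. K \<subseteq> A \<and> compact K}. emeasure (distr P borel T) K)" .
    show "(SUP K\<in>{K. K \<subseteq> A \<and> compact K}. emeasure (distr P borel T) K)
        \<le> emeasure (distr P borel T) A"
      using A by (intro SUP_least emeasure_mono) auto
  qed
  then show ?thesis
    using P.prob_space_distr[OF TM] by (simp add: radon_prob_def)
qed

text \<open>
  The continuous functions that are measurable for the product \<open>\<sigma>\<close>-algebra form an algebra that
  separates points, hence are uniformly dense.
\<close>

lemma borel_measurable_pair_continuous:
  fixes F :: "'a::t2_space \<times> 'b::t2_space \<Rightarrow> real"
  assumes ca: "compact (UNIV :: 'a set)" and cb: "compact (UNIV :: 'b set)"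
    and F: "continuous_on UNIV F"
  shows "F \<in> borel_measurable (borel \<Otimes>\<^sub>M borel)"
proof -
  let ?M = "borel \<Otimes>\<^sub>M borel :: ('a \<times> 'b) measure"
  define R :: "('a \<times> 'b \<Rightarrow> real) set" where "R = {f \<in> borel_measurable ?M. continuous_on UNIV f}"
  interpret function_ring_on R "UNIV :: ('a \<times> 'b) set"
  proof
    show "compact (UNIV :: ('a \<times> 'b) set)"
      using compact_Times[OF ca cb] by simp
    fix x y :: "'a \<times> 'b" assume "x \<noteq> y"
    then consider "fst x \<noteq> fst y" | "snd x \<noteq> snd y" by (auto simp: prod_eq_iff)
    then show "\<exists>f\<in>R. f x \<noteq> f y"
    proof cases
      case 1
      obtain f :: "'a \<Rightarrow> real" where f: "continuous_on UNIV f" "f (fst x) = 1" "f (fst y) = 0"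
        by (rule Urysohn_compact[OF ca, of "{fst x}" "{fst y}"]) (use 1 in auto)
      have "(\<lambda>z. f (fst z)) \<in> R" unfolding R_def
        using measurable_compose[OF measurable_fst borel_measurable_continuous_onI[OF f(1)]]
        by (auto intro!: continuous_on_compose2[OF f(1)] continuous_intros)
      then show ?thesis using f by (intro bexI[of _ "\<lambda>z. f (fst z)"]) auto
    next
      case 2
      obtain f :: "'b \<Rightarrow> real" where f: "continuous_on UNIV f" "f (snd x) = 1" "f (snd y) = 0"
        by (rule Urysohn_compact[OF cb, of "{snd x}" "{snd y}"]) (use 2 in auto)
      have "(\<lambda>z. f (snd z)) \<in> R" unfolding R_def
        using measurable_compose[OF measurable_snd borel_measurable_continuous_onI[OF f(1)]]
        by (auto intro!: continuous_on_compose2[OF f(1)] continuous_intros)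
      then show ?thesis using f by (intro bexI[of _ "\<lambda>z. f (snd z)"]) auto
    qed
  qed (auto simp: R_def intro!: continuous_intros)
  obtain G where G: "\<And>n. G n \<in> R" "uniform_limit UNIV G F sequentially"
    using Stone_Weierstrass[OF F] by auto
  show ?thesis
    by (rule borel_measurable_LIMSEQ_real[of ?M G])
      (use G(1) tendsto_uniform_limitI[OF G(2)] in \<open>auto simp: R_def\<close>)
qed

lemma integral_unit_interval:
  assumes "prob_space P" "f \<in> borel_measurable P" "\<And>x. 0 \<le> f x" "\<And>x. f x \<le> (1::real)"
  shows "0 \<le> (\<integral>x. f x \<partial>P)" "(\<integral>x. f x \<partial>P) \<le> 1"
proof -
  interpret prob_space P by fact
  show "0 \<le> (\<integral>x. f x \<partial>P)" using assms by (intro Bochner_Integration.integral_nonneg) auto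
  show "(\<integral>x. f x \<partial>P) \<le> 1"
    using assms by (intro integral_le_const integrable_const_bound[of _ 1]) auto
qed

text \<open>
  Domination by a countably additive measure gives continuity at the empty set, and thereby
  countable additivity.
\<close>

lemma dominated_measure_exists:
  fixes \<nu> :: "'a set \<Rightarrow> real"
  assumes P: "prob_space P"
    and bnd: "\<And>A. A \<in> sets P \<Longrightarrow> 0 \<le> \<nu> A" "\<And>A. A \<in> sets P \<Longrightarrow> \<nu> A \<le> measure P A"
    and add: "\<And>A B. A \<in> sets P \<Longrightarrow> B \<in> sets P \<Longrightarrow> A \<inter> B = {} \<Longrightarrow> \<nu> (A \<union> B) = \<nu> A + \<nu> B"
  obtains N where "sets N = sets P" "\<And>A. A \<in> sets P \<Longrightarrow> emeasure N A = ennreal (\<nu> A)"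
proof -
  interpret prob_space P by (rule P)
  let ?f = "\<lambda>A. ennreal (\<nu> A)"
  define N where "N = measure_of (space P) (sets P) ?f"
  have s: "sets N = sets P" unfolding N_def by simp
  have pos: "positive (sets P) ?f"
    using bnd[of "{}"] by (simp add: positive_def)
  have "countably_additive (sets P) ?f"
  proof (rule sets.empty_continuous_imp_countably_additive)
    show "positive (sets P) ?f" by (rule pos)
    show "additive (sets P) ?f"
      using add bnd by (simp add: additive_def)
    fix A :: "nat \<Rightarrow> 'a set" assume A: "range A \<subseteq> sets P" "decseq A" "(\<Inter>i. A i) = {}"
    have "(\<lambda>i. measure P (A i)) \<longlonglongrightarrow> 0"
      using finite_Lim_measure_decseq[OF A(1,2)] A(3) by simp
    have "(\<lambda>i. \<nu> (A i)) \<longlonglongrightarrow> 0"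
      by (rule tendsto_sandwich[OF _ _ tendsto_const \<open>(\<lambda>i. measure P (A i)) \<longlonglongrightarrow> 0\<close>]) (use A bnd in auto)
    from tendsto_ennrealI[OF this] show "(\<lambda>i. ennreal (\<nu> (A i))) \<longlonglongrightarrow> 0" by simp
  qed simp
  then have "emeasure N A = ennreal (\<nu> A)" if "A \<in> sets P" for A
    by (intro emeasure_measure_of[OF N_def]) (use that pos s sets.space_closed in auto)
  with s show ?thesis by (rule that)
qed

text \<open>
  Since the weights \<open>h n\<close> are bounded, convergence against indicators passes to their
  closure in \<open>L\<^sup>1\<close>.
\<close>

lemma tendsto_integral_of_indicators:
  fixes h :: "'i \<Rightarrow> 'a \<Rightarrow> real"
  assumes P: "prob_space P"
    and h: "\<And>n. h n \<in> borel_measurable P" "\<And>n x. 0 \<le> h n x" "\<And>n x. h n x \<le> 1"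
    and lim: "\<And>B. B \<in> sets P \<Longrightarrow> ((\<lambda>n. \<integral>x. h n x * indicator B x \<partial>P) \<longlongrightarrow> c * measure P B) F"
    and f: "integrable P (f :: 'a \<Rightarrow> real)"
  shows "((\<lambda>n. \<integral>x. h n x * f x \<partial>P) \<longlongrightarrow> c * (\<integral>x. f x \<partial>P)) F"
  using f
proof (induction rule: integrable_induct)
  case (base A r)
  have "((\<lambda>n. (\<integral>x. h n x * indicator A x \<partial>P) * r) \<longlongrightarrow> c * measure P A * r) F"
    by (intro tendsto_intros lim base)
  then show ?case using base by (simp add: mult.assoc[symmetric] sets.Int_space_eq2)
next
  case (add f g)
  have i: "integrable P (\<lambda>x. h n x * u x)" if "integrable P u" for n and u :: "'a \<Rightarrow> real"
    by (rule Bochner_Integration.integrable_bound[OF that])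
      (use h borel_measurable_integrable[OF that] in \<open>auto simp: abs_mult intro!: mult_left_le_one_le\<close>)
  show ?case
    using tendsto_add[OF add.IH] add.hyps by (simp add: distrib_left i)
next
  case (lim f u)
  have i: "integrable P (\<lambda>x. h n x * u x)" if "integrable P u" for n and u :: "'a \<Rightarrow> real"
    by (rule Bochner_Integration.integrable_bound[OF that])
      (use h borel_measurable_integrable[OF that] in \<open>auto simp: abs_mult intro!: mult_left_le_one_le\<close>)
  have "(\<lambda>k. \<integral>x. \<bar>u k x - f x\<bar> \<partial>P) \<longlonglongrightarrow> (\<integral>x. 0 \<partial>P)"
  proof (rule integral_dominated_convergence)
    show "integrable P (\<lambda>x. 3 * \<bar>f x\<bar>)" using lim.hyps by simp
    show "AE x in P. (\<lambda>k. \<bar>u k x - f x\<bar>) \<longlonglongrightarrow> 0"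
    proof (rule AE_I2)
      fix x assume "x \<in> space P"
      then show "(\<lambda>k. \<bar>u k x - f x\<bar>) \<longlonglongrightarrow> 0"
        using tendsto_rabs[OF tendsto_diff[OF lim.hyps(2) tendsto_const], of x "f x"] by simp
    qed
    show "AE x in P. norm \<bar>u k x - f x\<bar> \<le> 3 * \<bar>f x\<bar>" for k
      using lim.hyps(3)[of _ k] by (intro AE_I2) force
  qed (use lim.hyps in auto)
  then have d0: "(\<lambda>k. \<integral>x. \<bar>u k x - f x\<bar> \<partial>P) \<longlonglongrightarrow> 0" by simp
  have d: "\<bar>(\<integral>x. v x * u k x \<partial>P) - (\<integral>x. v x * f x \<partial>P)\<bar> \<le> (\<integral>x. \<bar>u k x - f x\<bar> \<partial>P)"
    if "\<And>x. 0 \<le> v x" "\<And>x. v x \<le> 1" "\<And>w. integrable P w \<Longrightarrow> integrable P (\<lambda>x. v x * w x)"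
    for v :: "'a \<Rightarrow> real" and k
  proof -
    have "(\<integral>x. v x * u k x \<partial>P) - (\<integral>x. v x * f x \<partial>P) = (\<integral>x. v x * (u k x - f x) \<partial>P)"
      using lim.hyps that(3) by (simp add: right_diff_distrib)
    also have "\<bar>\<dots>\<bar> \<le> (\<integral>x. \<bar>v x * (u k x - f x)\<bar> \<partial>P)" by (rule integral_abs_bound)
    also have "\<dots> \<le> (\<integral>x. \<bar>u k x - f x\<bar> \<partial>P)"
      using lim.hyps that
      by (intro integral_mono integrable_abs that(3)) (auto simp: abs_mult intro!: mult_left_le_one_le)
    finally show ?thesis .
  qed
  show ?case
  proof (rule tendstoI)
    fix e :: real assume e: "0 < e"
    (* Exchanging u k for f costs at most \<delta> in the integral with weight h n and at most \<bar>c\<bar> * \<delta> in the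
       limit; convergence for u k costs another \<delta>. *)
    define \<delta> where "\<delta> = e / (2 + \<bar>c\<bar>) / 2"
    have \<delta>: "\<delta> > 0" using e by (simp add: \<delta>_def)
    obtain k where k: "(\<integral>x. \<bar>u k x - f x\<bar> \<partial>P) < \<delta>"
      using order_tendstoD(2)[OF d0 \<delta>] by (auto simp: eventually_sequentially)
    have "\<forall>\<^sub>F n in F. dist (\<integral>x. h n x * u k x \<partial>P) (c * (\<integral>x. u k x \<partial>P)) < \<delta>"
      using lim.IH[of k] \<delta> by (rule tendstoD)
    then show "\<forall>\<^sub>F n in F. dist (\<integral>x. h n x * f x \<partial>P) (c * (\<integral>x. f x \<partial>P)) < e"
    proof eventually_elim
      case (elim n)
      have 1: "\<bar>(\<integral>x. h n x * u k x \<partial>P) - (\<integral>x. h n x * f x \<partial>P)\<bar> < \<delta>"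
        using d[of "h n" k] h i k by force
      have "\<bar>c * (\<integral>x. u k x \<partial>P) - c * (\<integral>x. f x \<partial>P)\<bar> = \<bar>c\<bar> * \<bar>(\<integral>x. u k x \<partial>P) - (\<integral>x. f x \<partial>P)\<bar>"
        by (simp add: abs_mult right_diff_distrib[symmetric])
      also have "\<dots> \<le> \<bar>c\<bar> * \<delta>"
        using d[of "\<lambda>_. 1" k] k by (intro mult_left_mono) auto
      finally have "dist (\<integral>x. h n x * f x \<partial>P) (c * (\<integral>x. f x \<partial>P)) < \<delta> * (2 + \<bar>c\<bar>)"
        using 1 elim unfolding dist_real_def by (simp add: algebra_simps)
      also have "\<delta> * (2 + \<bar>c\<bar>) = e / 2" unfolding \<delta>_def by (simp add: field_simps)
      also have "\<dots> < e" using e by simp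
      finally show ?case .
    qed
  qed
qed

section \<open>Solutions and their increments\<close>

lemma continuous_on_coordinate [continuous_intros]:
  "continuous_on S (\<lambda>\<eta> :: 'a \<Rightarrow> 'b::topological_space. \<eta> j)"
  by (rule continuous_on_subset[OF continuous_on_product_coordinates]) simp

lemma continuous_on_increment:
  "continuous_on UNIV (increment n :: (nat \<Rightarrow> 'g::topological_group_add) \<Rightarrow> 'g)"
  unfolding increment_def by (intro continuous_intros)

lemma measurable_increment:
  "(increment n :: (nat \<Rightarrow> 'g::topological_group_add) \<Rightarrow> 'g) \<in> borel_measurable borel"
  by (rule borel_measurable_continuous_onI[OF continuous_on_increment])

lemma space_past [simp]: "space (past n) = UNIV"
  by (simp add: past_def space_measure_of_conv)

lemma measurable_coordinate_past:
  "n \<le> j \<Longrightarrow> (\<lambda>\<eta>. \<eta> j) \<in> borel_measurable (past n)"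
  unfolding past_def
  by (rule measurableI) (auto simp: space_measure_of_conv intro!: sigma_sets.Basic)

lemma past_measurable_imp_measurable:
  assumes "\<And>j. n \<le> j \<Longrightarrow> (\<lambda>\<eta> :: nat \<Rightarrow> 'g::topological_space. \<eta> j) \<in> borel_measurable N"
    and "space N = UNIV" and "f \<in> measurable (past n) M"
  shows "f \<in> measurable N M"
proof -
  have "sigma_sets (space N) (\<Union>j\<in>{n..}. {(\<lambda>\<eta> :: nat \<Rightarrow> 'g. \<eta> j) -` A | A. A \<in> sets borel}) \<subseteq> sets N"
    by (rule sets.sigma_sets_subset) (use assms(2) measurable_sets[OF assms(1)] in auto)
  then have "sets (past n :: (nat \<Rightarrow> 'g) measure) \<subseteq> sets N"
    by (simp add: past_def assms(2))
  then show ?thesis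
    using assms by (auto simp: measurable_def)
qed

lemma past_measurable_antimono:
  assumes "n \<le> m" "f \<in> measurable (past m) M"
  shows "f \<in> measurable (past n) M"
  by (rule past_measurable_imp_measurable[OF _ _ assms(2)])
    (use assms(1) in \<open>auto intro: measurable_coordinate_past\<close>)

lemma past_measurable_imp_borel:
  assumes "f \<in> measurable (past n) M"
  shows "f \<in> measurable borel M"
  by (rule past_measurable_imp_measurable[OF _ _ assms])
    (auto intro!: borel_measurable_continuous_onI continuous_intros)

lemma sets_past_subset_borel: "sets (past n :: (nat \<Rightarrow> 'g::topological_space) measure) \<subseteq> sets borel"
proof
  fix B :: "(nat \<Rightarrow> 'g) set" assume "B \<in> sets (past n)"
  then have "(\<lambda>x. x) -` B \<inter> space borel \<in> sets borel"
    by (intro measurable_sets[OF past_measurable_imp_borel[OF measurable_ident_sets[OF refl]]])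
  then show "B \<in> sets borel" by simp
qed

text \<open>
  The increment itself need not be measurable for the \<open>\<sigma>\<close>-algebra generated by the coordinates, unlike its
  continuous real functions.
\<close>

lemma measurable_increment_past:
  fixes b :: "'g::{topological_group_add, t2_space} \<Rightarrow> real"
  assumes c: "compact (UNIV :: 'g set)" and b: "continuous_on UNIV b" and n: "n \<le> k"
  shows "(\<lambda>\<eta>. b (increment k \<eta>)) \<in> borel_measurable (past n)"
proof -
  have "(\<lambda>z :: 'g \<times> 'g. b (- fst z + snd z)) \<in> borel_measurable (borel \<Otimes>\<^sub>M borel)"
    by (intro borel_measurable_pair_continuous c continuous_on_compose2[OF b] continuous_intros) auto
  note F = this
  have "(\<lambda>\<eta> :: nat \<Rightarrow> 'g. (\<eta> (Suc k), \<eta> k)) \<in> measurable (past n) (borel \<Otimes>\<^sub>M borel)"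
    using n by (intro measurable_Pair measurable_coordinate_past) auto
  from measurable_compose[OF this F] show ?thesis
    by (simp add: increment_def)
qed

lemma solutionsD:
  assumes "P \<in> solutions \<mu>"
  shows "radon_prob P" "prob_space P" "sets P = sets borel" "space P = UNIV"
    "distr P borel (increment n) = \<mu> n"
    "\<And>B C. B \<in> sets (past (Suc n)) \<Longrightarrow> C \<in> sets borel \<Longrightarrow>
      measure P (increment n -` C \<inter> B) = measure (\<mu> n) C * measure P B"
    "measure P UNIV = 1"
proof -
  show r: "radon_prob P" and d: "distr P borel (increment n) = \<mu> n"
    using assms by (auto simp: solutions_def)
  then show p: "prob_space P" and s: "sets P = sets borel" by (auto simp: radon_prob_def)
  show sp: "space P = UNIV" using sets_eq_imp_space_eq[OF s] by simp
  interpret prob_space P by (rule p)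
  show "measure P UNIV = 1" using prob_space sp by simp
  fix B :: "(nat \<Rightarrow> 'a) set" and C :: "'a set"
  assume B: "B \<in> sets (past (Suc n))" and C: "C \<in> sets borel"
  have i: "indep_set (sets (vimage_algebra UNIV (increment n) borel)) (sets (past (Suc n)))"
    using assms by (auto simp: solutions_def)
  have "increment n -` C \<inter> UNIV \<in> sets (vimage_algebra UNIV (increment n) borel)"
    by (rule in_vimage_algebra[OF C])
  from indep_setD[OF i this B]
  have "measure P (increment n -` C \<inter> B) = measure P (increment n -` C) * measure P B" by simp
  also have "measure P (increment n -` C) = measure (\<mu> n) C"
    unfolding d[symmetric] using C measurable_increment[of n] s sp
    by (subst measure_distr) (auto cong: measurable_cong_sets)
  finally show "measure P (increment n -` C \<inter> B) = measure (\<mu> n) C * measure P B" .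
qed

lemma solution_integral_step:
  fixes P :: "(nat \<Rightarrow> 'g::{topological_group_add, t2_space}) measure" and b :: "'g \<Rightarrow> real"
  assumes P: "P \<in> solutions \<mu>"
    and g: "g \<in> borel_measurable (past (Suc k))" "\<And>\<eta>. \<bar>g \<eta>\<bar> \<le> C"
    and b: "b \<in> borel_measurable borel" "\<And>x. \<bar>b x\<bar> \<le> D"
  shows "(\<integral>\<eta>. g \<eta> * b (increment k \<eta>) \<partial>P) = (\<integral>\<eta>. g \<eta> \<partial>P) * (\<integral>x. b x \<partial>\<mu> k)"
proof -
  note s = solutionsD[OF P]
  interpret prob_space P by (rule s(2))
  have gP: "g \<in> borel_measurable P"
    using past_measurable_imp_borel[OF g(1)] s(3) by (simp cong: measurable_cong_sets)
  have iP: "increment k \<in> borel_measurable P"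
    using measurable_increment s(3) by (simp cong: measurable_cong_sets)
  have bP: "(\<lambda>\<eta>. b (increment k \<eta>)) \<in> borel_measurable P"
    by (rule measurable_compose[OF iP b(1)])
  have i: "indep_set (sets (vimage_algebra UNIV (increment k) borel)) (sets (past (Suc k)))"
    using P by (auto simp: solutions_def)
  have "indep_var borel g borel (\<lambda>\<eta>. b (increment k \<eta>))"
    unfolding indep_var_eq
  proof (intro conjI gP bP)
    have 1: "sigma_sets (space P) {g -` A \<inter> space P |A. A \<in> sets borel} \<subseteq> sets (past (Suc k))"
    proof -
      have "{g -` A \<inter> space P |A. A \<in> sets borel} \<subseteq> sets (past (Suc k))"
        using measurable_sets[OF g(1)] s(4) by auto
      from sets.sigma_sets_subset[OF this] show ?thesis using s(4) by simp
    qed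
    let ?V = "vimage_algebra UNIV (increment k) borel"
    have "increment k \<in> measurable ?V borel"
      by (rule measurable_vimage_algebra1) simp
    note m = measurable_compose[OF this b(1)]
    have 2: "sigma_sets (space P) {(\<lambda>\<eta>. b (increment k \<eta>)) -` A \<inter> space P |A. A \<in> sets borel}
        \<subseteq> sets ?V"
    proof -
      have "{(\<lambda>\<eta>. b (increment k \<eta>)) -` A \<inter> space P |A. A \<in> sets borel} \<subseteq> sets ?V"
        using measurable_sets[OF m] s(4) by auto
      from sets.sigma_sets_subset[OF this] show ?thesis using s(4) by simp
    qed
    show "indep_set (sigma_sets (space P) {g -` A \<inter> space P |A. A \<in> sets borel})
        (sigma_sets (space P) {(\<lambda>\<eta>. b (increment k \<eta>)) -` A \<inter> space P |A. A \<in> sets borel})"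
      unfolding indep_sets2_eq
    proof (intro conjI ballI)
      fix X Y assume "X \<in> sigma_sets (space P) {g -` A \<inter> space P |A. A \<in> sets borel}"
        and "Y \<in> sigma_sets (space P) {(\<lambda>\<eta>. b (increment k \<eta>)) -` A \<inter> space P |A. A \<in> sets borel}"
      then have "prob (Y \<inter> X) = prob Y * prob X" using 1 2 by (intro indep_setD[OF i]) auto
      then show "prob (X \<inter> Y) = prob X * prob Y" by (simp add: Int_commute mult.commute)
    qed (use 1 2 indep_setD_ev1[OF i] indep_setD_ev2[OF i] in auto)
  qed
  then have "(\<integral>\<eta>. g \<eta> * b (increment k \<eta>) \<partial>P) = (\<integral>\<eta>. g \<eta> \<partial>P) * (\<integral>\<eta>. b (increment k \<eta>) \<partial>P)"
    using gP bP g(2) b(2)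
    by (intro indep_var_lebesgue_integral integrable_const_bound[of _ C] integrable_const_bound[of _ D]) auto
  also have "(\<integral>\<eta>. b (increment k \<eta>) \<partial>P) = (\<integral>x. b x \<partial>\<mu> k)"
    unfolding s(5)[symmetric] by (rule integral_distr[symmetric, OF iP b(1)])
  finally show ?thesis .
qed

text \<open>
  Each increment is independent of its past, to which continuous functions of all earlier
  increments belong, so the factors separate one at a time.
\<close>

lemma solution_integral_prod:
  fixes P :: "(nat \<Rightarrow> 'g::{topological_group_add, t2_space}) measure" and b :: "nat \<Rightarrow> 'g \<Rightarrow> real"
  assumes P: "P \<in> solutions \<mu>" and c: "compact (UNIV :: 'g set)"
    and b: "\<And>k. continuous_on UNIV (b k)"
    and g: "g \<in> borel_measurable (past n)" "\<And>\<eta>. \<bar>g \<eta>\<bar> \<le> C"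
  shows "(\<integral>\<eta>. g \<eta> * (\<Prod>k<n. b k (increment k \<eta>)) \<partial>P) = (\<integral>\<eta>. g \<eta> \<partial>P) * (\<Prod>k<n. \<integral>x. b k x \<partial>\<mu> k)"
  using g
proof (induction n arbitrary: g C)
  case (Suc n)
  obtain D where D: "0 \<le> D" "\<And>x. \<bar>b n x\<bar> \<le> D"
    using bounded_continuous_compact[OF c b] by blast
  have "(\<integral>\<eta>. g \<eta> * (\<Prod>k<Suc n. b k (increment k \<eta>)) \<partial>P)
      = (\<integral>\<eta>. (g \<eta> * b n (increment n \<eta>)) * (\<Prod>k<n. b k (increment k \<eta>)) \<partial>P)"
    by (simp add: mult_ac)
  also have "\<dots> = (\<integral>\<eta>. g \<eta> * b n (increment n \<eta>) \<partial>P) * (\<Prod>k<n. \<integral>x. b k x \<partial>\<mu> k)"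
  proof (rule Suc.IH)
    show "(\<lambda>\<eta>. g \<eta> * b n (increment n \<eta>)) \<in> borel_measurable (past n)"
      using past_measurable_antimono[OF _ Suc.prems(1)] measurable_increment_past[OF c b]
      by (intro borel_measurable_times) auto
    show "\<bar>g \<eta> * b n (increment n \<eta>)\<bar> \<le> C * D" for \<eta>
      unfolding abs_mult using Suc.prems(2)[of \<eta>] D
      by (intro mult_mono) (auto intro: order_trans[OF abs_ge_zero])
  qed
  also have "(\<integral>\<eta>. g \<eta> * b n (increment n \<eta>) \<partial>P) = (\<integral>\<eta>. g \<eta> \<partial>P) * (\<integral>x. b n x \<partial>\<mu> n)"
    by (rule solution_integral_step[OF P Suc.prems borel_measurable_continuous_onI[OF b] D(2)])
  finally show ?case by (simp add: mult_ac)
qed simp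

section \<open>Measures dominated by an extremal solution\<close>

text \<open>
  The measure is \<open>\<nu> / \<nu> UNIV\<close>; its inner regularity is inherited from \<open>P\<close> because \<open>\<nu> \<le> P\<close> also holds
  on the difference of a set and a compact subset.
\<close>

lemma solution_of_dominated:
  fixes P :: "(nat \<Rightarrow> 'g::{topological_group_add, t2_space}) measure"
  assumes P: "P \<in> solutions \<mu>" and \<mu>: "\<And>n. sets (\<mu> n) = sets borel"
    and bnd: "\<And>A. A \<in> sets borel \<Longrightarrow> 0 \<le> \<nu> A" "\<And>A. A \<in> sets borel \<Longrightarrow> \<nu> A \<le> measure P A"
    and add: "\<And>A B. A \<in> sets borel \<Longrightarrow> B \<in> sets borel \<Longrightarrow> A \<inter> B = {} \<Longrightarrow> \<nu> (A \<union> B) = \<nu> A + \<nu> B"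
    and ind: "\<And>n B C. B \<in> sets (past (Suc n)) \<Longrightarrow> C \<in> sets borel \<Longrightarrow>
      \<nu> (increment n -` C \<inter> B) = measure (\<mu> n) C * \<nu> B"
    and pos: "0 < \<nu> UNIV"
  obtains Q where "Q \<in> solutions \<mu>" "\<And>A. A \<in> sets borel \<Longrightarrow> measure Q A = \<nu> A / \<nu> UNIV"
proof -
  note s = solutionsD[OF P]
  interpret P: prob_space P by (rule s(2))
  define c where "c = \<nu> UNIV"
  have c: "0 < c" "c \<le> 1" using pos bnd(2)[of UNIV] s(7) by (auto simp: c_def)
  obtain N where N: "sets N = sets borel" "\<And>A. A \<in> sets borel \<Longrightarrow> emeasure N A = ennreal (\<nu> A)"
    by (rule dominated_measure_exists[OF s(2), of \<nu>]) (use bnd add s(3) in auto)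
  define Q where "Q = density N (\<lambda>_. ennreal (1 / c))"
  have sQ: "sets Q = sets borel" by (simp add: Q_def N)
  have spQ: "space Q = UNIV" using sets_eq_imp_space_eq[OF sQ] by simp
  have eQ: "emeasure Q A = ennreal (\<nu> A / c)" if "A \<in> sets borel" for A
    using that N bnd(1)[OF that] c
    by (simp add: Q_def emeasure_density nn_integral_cmult_indicator ennreal_mult[symmetric])
  have Q: "prob_space Q"
    by (rule prob_spaceI) (use eQ[of UNIV] spQ c in \<open>simp add: c_def\<close>)
  interpret Q: prob_space Q by (rule Q)
  have mQ: "measure Q A = \<nu> A / c" if "A \<in> sets borel" for A
    using eQ[OF that] bnd(1)[OF that] c by (simp add: measure_def)
  have radon: "radon_prob Q"
    unfolding radon_prob_def
  proof (intro conjI Q sQ ballI ennreal_approx_SUP)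
    fix A :: "(nat \<Rightarrow> 'g) set" assume A: "A \<in> sets borel"
    show "emeasure Q K \<le> emeasure Q A" if "K \<in> {K. K \<subseteq> A \<and> compact K}" for K
      using that A sQ by (intro emeasure_mono) auto
    fix e :: real assume e: "0 < e"
    have "\<exists>K\<in>{K. K \<subseteq> A \<and> compact K}. emeasure P A < emeasure P K + ennreal (e * c)"
    proof (rule SUP_approx_ennreal)
      show "{K. K \<subseteq> A \<and> compact K} \<noteq> {}" using compact_empty by blast
      show "emeasure P A = (SUP K\<in>{K. K \<subseteq> A \<and> compact K}. emeasure P K)"
        using s(1) A by (simp add: radon_prob_def)
    qed (use e c in \<open>simp_all add: P.emeasure_eq_measure\<close>)
    then obtain K where K: "K \<subseteq> A" "compact K" "emeasure P A < emeasure P K + ennreal (e * c)"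
      by blast
    have bK: "K \<in> sets borel" using K(2) by (intro borel_closed compact_imp_closed)
    have "measure P A < measure P K + e * c"
      using K(3) e c by (simp add: P.emeasure_eq_measure ennreal_less_iff flip: ennreal_plus)
    moreover have "measure P (A - K) = measure P A - measure P K"
      using A bK K(1) s(3) by (intro P.finite_measure_Diff) auto
    moreover have "\<nu> A = \<nu> K + \<nu> (A - K)"
      using add[of K "A - K"] A bK K(1) by (simp add: Un_absorb1)
    ultimately have "\<nu> A \<le> \<nu> K + e * c"
      using bnd(2)[of "A - K"] A bK by auto
    (* Dividing by c = \<nu> UNIV turns the error e * c into e. *)
    then have "measure Q A \<le> measure Q K + e"
      using A bK c by (simp add: mQ field_simps)
    then show "\<exists>K\<in>{K. K \<subseteq> A \<and> compact K}. emeasure Q A \<le> emeasure Q K + ennreal e"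
      using K e by (intro bexI[of _ K]) (auto simp: Q.emeasure_eq_measure simp flip: ennreal_plus)
  qed
  have iQ: "increment n \<in> measurable Q borel" for n
    using measurable_increment sQ by (simp cong: measurable_cong_sets)
  have inc: "measure Q (increment n -` C) = measure (\<mu> n) C" if "C \<in> sets borel" for n C
  proof -
    have "UNIV \<in> sets (past (Suc n) :: (nat \<Rightarrow> 'g) measure)"
      using sets.top[of "past (Suc n) :: (nat \<Rightarrow> 'g) measure"] by simp
    moreover have "increment n -` C \<in> sets borel"
      using measurable_sets[OF measurable_increment[of n] that] by simp
    ultimately show ?thesis using ind[OF _ that, of UNIV n] c by (simp add: mQ c_def)
  qed
  have "Q \<in> solutions \<mu>"
    unfolding solutions_def
  proof (intro CollectI conjI allI radon)
    fix n
    have "increment n \<in> measurable P borel"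
      using measurable_increment s(3) by (simp cong: measurable_cong_sets)
    then have fin: "finite_measure (\<mu> n)"
      using P.prob_space_distr s(5) prob_space.finite_measure by metis
    show "distr Q borel (increment n) = \<mu> n"
    proof (rule measure_eqI)
      fix C :: "'g set" assume "C \<in> sets (distr Q borel (increment n))"
      then have C: "C \<in> sets borel" by simp
      have "emeasure (distr Q borel (increment n)) C = ennreal (measure (\<mu> n) C)"
        using inc[OF C] C iQ spQ by (simp add: emeasure_distr Q.emeasure_eq_measure)
      also have "\<dots> = emeasure (\<mu> n) C"
        by (rule finite_measure.emeasure_eq_measure[symmetric, OF fin])
      finally show "emeasure (distr Q borel (increment n)) C = emeasure (\<mu> n) C" .
    qed (simp add: \<mu>)
    show "Q.indep_set (sets (vimage_algebra UNIV (increment n) borel)) (sets (past (Suc n)))"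
      unfolding Q.indep_sets2_eq
    proof (intro conjI ballI)
      show "sets (past (Suc n)) \<subseteq> Q.events" using sets_past_subset_borel sQ by blast
      have V: "\<exists>C\<in>sets borel. X = increment n -` C"
        if "X \<in> sets (vimage_algebra UNIV (increment n) borel)" for X :: "(nat \<Rightarrow> 'g) set"
        using that by (auto simp: sets_vimage_algebra2)
      then show "sets (vimage_algebra UNIV (increment n) borel) \<subseteq> Q.events"
        using measurable_sets[OF iQ] spQ by fastforce
      fix X B :: "(nat \<Rightarrow> 'g) set"
      assume X: "X \<in> sets (vimage_algebra UNIV (increment n) borel)" and B: "B \<in> sets (past (Suc n))"
      obtain C where C: "C \<in> sets borel" "X = increment n -` C" using V[OF X] by blast
      have bB: "B \<in> sets borel" using B sets_past_subset_borel by blast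
      have "increment n -` C \<in> sets borel"
        using measurable_sets[OF measurable_increment[of n] C(1)] by simp
      then show "measure Q (X \<inter> B) = measure Q X * measure Q B"
        using inc[OF C(1)] ind[OF B C(1)] bB C(2) by (simp add: mQ)
    qed
  qed
  then show ?thesis using mQ unfolding c_def by (rule that)
qed

text \<open>
  If \<open>\<nu>\<close> is a proper part of \<open>P\<close>, then \<open>P\<close> is a convex combination of the normalizations of \<open>\<nu>\<close> and
  of \<open>P - \<nu>\<close>, both of which are solutions.  The set functions to have in mind are
  \<open>B \<mapsto> E[W; \<eta> \<in> B]\<close> for a weight \<open>W\<close> between 0 and 1 that does not disturb the independence of noise and past.
\<close>

lemma extremal_dominated:
  fixes P :: "(nat \<Rightarrow> 'g::{topological_group_add, t2_space}) measure"
  assumes P: "P \<in> extremal (solutions \<mu>)" and \<mu>: "\<And>n. sets (\<mu> n) = sets borel"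
    and bnd: "\<And>A. A \<in> sets borel \<Longrightarrow> 0 \<le> \<nu> A" "\<And>A. A \<in> sets borel \<Longrightarrow> \<nu> A \<le> measure P A"
    and add: "\<And>A B. A \<in> sets borel \<Longrightarrow> B \<in> sets borel \<Longrightarrow> A \<inter> B = {} \<Longrightarrow> \<nu> (A \<union> B) = \<nu> A + \<nu> B"
    and ind: "\<And>n B C. B \<in> sets (past (Suc n)) \<Longrightarrow> C \<in> sets borel \<Longrightarrow>
      \<nu> (increment n -` C \<inter> B) = measure (\<mu> n) C * \<nu> B"
    and A: "A \<in> sets borel"
  shows "\<nu> A = \<nu> UNIV * measure P A"
proof -
  have Ps: "P \<in> solutions \<mu>" using P by (simp add: extremal_def)
  note s = solutionsD[OF Ps]
  interpret P: prob_space P by (rule s(2))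
  have P1: "measure P UNIV = 1" using P.prob_space s(4) by simp
  define \<nu>' where "\<nu>' A = measure P A - \<nu> A" for A
  have compl: "\<nu> UNIV = \<nu> A + \<nu> (- A)" "measure P UNIV = measure P A + measure P (- A)"
    using add[of A "- A"] P.finite_measure_Union[of A "- A"] A s(3) by auto
  consider "\<nu> UNIV = 0" | "\<nu> UNIV = 1" | "0 < \<nu> UNIV" "\<nu> UNIV < 1"
    using bnd[of UNIV] P1 by force
  then show ?thesis
  proof cases
    case 1
    then show ?thesis using compl bnd(1)[of A] bnd(1)[of "- A"] A by auto
  next
    case 2
    then show ?thesis using compl P1 bnd(2)[of A] bnd(2)[of "- A"] A by auto
  next
    case 3
    obtain Q where Q: "Q \<in> solutions \<mu>" "\<And>A. A \<in> sets borel \<Longrightarrow> measure Q A = \<nu> A / \<nu> UNIV"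
      using solution_of_dominated[OF Ps \<mu> bnd add ind 3(1)] by blast
    obtain R where R: "R \<in> solutions \<mu>" "\<And>A. A \<in> sets borel \<Longrightarrow> measure R A = \<nu>' A / \<nu>' UNIV"
    proof (rule solution_of_dominated[OF Ps \<mu>, of \<nu>'])
      show "0 \<le> \<nu>' A" "\<nu>' A \<le> measure P A" if "A \<in> sets borel" for A
        using bnd[OF that] by (auto simp: \<nu>'_def)
      show "\<nu>' (A \<union> B) = \<nu>' A + \<nu>' B" if "A \<in> sets borel" "B \<in> sets borel" "A \<inter> B = {}" for A B
        using add[OF that] P.finite_measure_Union[of A B] that s(3) by (simp add: \<nu>'_def)
      show "\<nu>' (increment n -` C \<inter> B) = measure (\<mu> n) C * \<nu>' B"
        if "B \<in> sets (past (Suc n))" "C \<in> sets borel" for n B C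
        using ind[OF that] s(6)[OF that] by (simp add: \<nu>'_def right_diff_distrib)
      show "0 < \<nu>' UNIV" using 3 P1 by (simp add: \<nu>'_def)
    qed (use that in blast)
    have "\<forall>A\<in>sets P. measure P A = \<nu> UNIV * measure Q A + (1 - \<nu> UNIV) * measure R A"
      using 3 P1 s(3) by (auto simp: Q(2) R(2) \<nu>'_def)
    then have "Q = R" using P Q(1) R(1) 3 unfolding extremal_def by blast
    then have "\<nu> A / \<nu> UNIV = (measure P A - \<nu> A) / (1 - \<nu> UNIV)"
      using Q(2)[OF A] R(2)[OF A] P1 by (simp add: \<nu>'_def)
    then show ?thesis using 3 by (simp add: field_simps)
  qed
qed

lemma integrable_continuous_solution:
  fixes P :: "(nat \<Rightarrow> 'g::{topological_group_add, t2_space}) measure"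
  assumes P: "P \<in> solutions \<mu>" and c: "compact (UNIV :: 'g set)"
    and f: "continuous_on UNIV (f :: _ \<Rightarrow> real)"
  shows "integrable P f"
proof -
  interpret prob_space P by (rule solutionsD(2)[OF P])
  obtain C where "\<And>\<eta>. \<bar>f \<eta>\<bar> \<le> C"
    using bounded_continuous_compact[OF compact_UNIV_fun[OF c] f] by blast
  then show ?thesis
    using borel_measurable_continuous_onI[OF f] solutionsD(3)[OF P]
    by (intro integrable_const_bound[of _ C]) (auto cong: measurable_cong_sets)
qed

section \<open>Approximation by products of increments\<close>

text \<open>
  Filling up with a constant, rather than restricting, keeps the truncated paths in the same type;
  they form a compact set that stands for the product of the coordinate spaces with indices \<open>0, \<dots>, n\<close>.
\<close>

definition trunc :: "nat \<Rightarrow> (nat \<Rightarrow> 'g) \<Rightarrow> nat \<Rightarrow> 'g::zero" where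
  "trunc n \<eta> j = (if j \<le> n then \<eta> j else 0)"

lemma continuous_on_trunc:
  "continuous_on UNIV (trunc n :: (nat \<Rightarrow> 'g::{zero, topological_space}) \<Rightarrow> _)"
proof (rule continuous_on_coordinatewise_then_product)
  fix j
  show "continuous_on UNIV (\<lambda>\<eta> :: nat \<Rightarrow> 'g. trunc n \<eta> j)"
    by (cases "j \<le> n") (simp_all add: trunc_def)
qed

text \<open>
  The value at time \<open>-n\<close> and the later increments are coordinates for the path from time \<open>-n\<close> on; these are the sums
  of products of functions of the single coordinates, on which independence can be
  applied factor by factor.
\<close>

inductive_set tensors :: "nat \<Rightarrow> ((nat \<Rightarrow> 'g::topological_group_add) \<Rightarrow> real) set" for n where
  prod: "continuous_on UNIV a \<Longrightarrow> (\<And>k. continuous_on UNIV (b k)) \<Longrightarrow>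
    (\<lambda>\<eta>. a (\<eta> n) * (\<Prod>k<n. b k (increment k \<eta>))) \<in> tensors n"
| add: "f \<in> tensors n \<Longrightarrow> g \<in> tensors n \<Longrightarrow> (\<lambda>\<eta>. f \<eta> + g \<eta>) \<in> tensors n"

lemma tensors_mult:
  assumes "f \<in> tensors n" "g \<in> tensors n"
  shows "(\<lambda>\<eta>. f \<eta> * g \<eta>) \<in> tensors n"
  using assms
proof (induction rule: tensors.induct)
  case (prod a b)
  note ab = prod.hyps
  from prod.prems show ?case
  proof (induction rule: tensors.induct)
    case (prod a' b')
    have "(\<lambda>\<eta>. (\<lambda>x. a x * a' x) (\<eta> n) * (\<Prod>k<n. (\<lambda>k x. b k x * b' k x) k (increment k \<eta>))) \<in> tensors n"
      by (rule tensors.prod) (intro continuous_intros ab prod)+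
    then show ?case by (simp add: prod.distrib mult_ac)
  next
    case (add f g)
    then show ?case using tensors.add by (fastforce simp: distrib_left)
  qed
next
  case (add f h)
  then show ?case using tensors.add by (fastforce simp: distrib_right)
qed

lemma continuous_on_tensors:
  assumes "f \<in> tensors n"
  shows "continuous_on UNIV f"
  using assms
proof (induction rule: tensors.induct)
  case (prod a b)
  show ?case
    by (intro continuous_intros continuous_on_compose2[OF prod(1)] continuous_on_compose2[OF prod(2)]
        continuous_on_increment) auto
qed (intro continuous_intros)

lemma tensors_trunc:
  assumes "f \<in> tensors n"
  shows "f (trunc n \<eta>) = f \<eta>"
  using assms by (induction rule: tensors.induct) (simp_all add: trunc_def increment_def)

lemma eq_if_increments_eq:
  assumes "x n = y n" "\<And>k. k < n \<Longrightarrow> increment k x = increment k y" "j \<le> n"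
  shows "x j = y j"
  using assms(3)
proof (induction rule: inc_induct)
  case (step k)
  then show ?case using assms(2)[of k] by (simp add: increment_def)
qed (rule assms(1))

text \<open>
  Stone-Weierstrass on the compact set of truncated paths: two paths that agree at time \<open>-n\<close> and have
  the same later increments agree from time \<open>-n\<close> on.
\<close>

lemma tensors_dense:
  fixes f :: "(nat \<Rightarrow> 'g::{topological_group_add, t2_space}) \<Rightarrow> real"
  assumes c: "compact (UNIV :: 'g set)" and f: "continuous_on UNIV f"
    and dep: "\<And>\<eta>. f (trunc n \<eta>) = f \<eta>" and e: "0 < e"
  shows "\<exists>g\<in>tensors n. \<forall>\<eta>. \<bar>f \<eta> - g \<eta>\<bar> < e"
proof -
  interpret function_ring_on "tensors n" "range (trunc n :: (nat \<Rightarrow> 'g) \<Rightarrow> _)"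
  proof
    show "compact (range (trunc n :: (nat \<Rightarrow> 'g) \<Rightarrow> _))"
      by (intro compact_continuous_image continuous_on_trunc compact_UNIV_fun c)
    show "continuous_on (range (trunc n)) h" if "h \<in> tensors n" for h :: "(nat \<Rightarrow> 'g) \<Rightarrow> real"
      using continuous_on_tensors[OF that] by (rule continuous_on_subset) simp
    show "(\<lambda>_. r) \<in> tensors n" for r :: real
      using tensors.prod[of "\<lambda>_. r" "\<lambda>_ _. 1" n] by simp
    fix x y :: "nat \<Rightarrow> 'g" assume xy: "x \<in> range (trunc n)" "y \<in> range (trunc n)" "x \<noteq> y"
    then obtain j where "x j \<noteq> y j" by auto
    moreover from this have "j \<le> n" using xy by (auto simp: trunc_def split: if_splits)
    ultimately consider "x n \<noteq> y n" | k where "k < n" "increment k x \<noteq> increment k y"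
      using eq_if_increments_eq[of x n y j] by blast
    then show "\<exists>f\<in>tensors n. f x \<noteq> f y"
    proof cases
      case 1
      obtain a :: "'g \<Rightarrow> real" where a: "continuous_on UNIV a" "a (x n) = 1" "a (y n) = 0"
        by (rule Urysohn_compact[OF c, of "{x n}" "{y n}"]) (use 1 in auto)
      have "(\<lambda>\<eta>. a (\<eta> n)) \<in> tensors n"
        using tensors.prod[OF a(1), of "\<lambda>_ _. 1" n] by simp
      then show ?thesis using a by (intro bexI[of _ "\<lambda>\<eta>. a (\<eta> n)"]) auto
    next
      case 2
      obtain a :: "'g \<Rightarrow> real" where a: "continuous_on UNIV a" "a (increment k x) = 1" "a (increment k y) = 0"
        by (rule Urysohn_compact[OF c, of "{increment k x}" "{increment k y}"]) (use 2 in auto)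
      have "(\<lambda>\<eta>. 1 * (\<Prod>i<n. (if i = k then a else (\<lambda>_. 1)) (increment i \<eta>))) \<in> tensors n"
        by (rule tensors.prod[of "\<lambda>_. 1"]) (use a(1) in auto)
      moreover have "(\<Prod>i<n. (if i = k then a else (\<lambda>_. 1)) (increment i \<eta>)) = a (increment k \<eta>)" for \<eta>
      proof -
        have "(\<Prod>i<n. (if i = k then a else (\<lambda>_. 1)) (increment i \<eta>))
            = (\<Prod>i<n. if i = k then a (increment i \<eta>) else 1)"
          by (rule prod.cong) auto
        then show ?thesis using 2(1) by simp
      qed
      ultimately have "(\<lambda>\<eta>. a (increment k \<eta>)) \<in> tensors n" by simp
      then show ?thesis using a by (intro bexI[of _ "\<lambda>\<eta>. a (increment k \<eta>)"]) auto
    qed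
  qed (auto intro: tensors.add tensors_mult)
  obtain g where g: "g \<in> tensors n" "\<And>\<eta>. \<bar>f (trunc n \<eta>) - g (trunc n \<eta>)\<bar> < e"
    using Stone_Weierstrass_basic[OF continuous_on_subset[OF f] e] by auto
  then show ?thesis using dep tensors_trunc[OF g(1)] by auto
qed

text \<open>
  Functions of finitely many coordinates are dense by Stone-Weierstrass on path space, and a function
  of the coordinates \<open>0, \<dots>, N\<close> also depends only on the coordinates \<open>0, \<dots>, n\<close> for every \<open>n \<ge> N\<close>.
\<close>

lemma tensors_eventually_dense:
  fixes f :: "(nat \<Rightarrow> 'g::{topological_group_add, t2_space}) \<Rightarrow> real"
  assumes c: "compact (UNIV :: 'g set)" and f: "continuous_on UNIV f" and e: "0 < e"
  shows "\<exists>N. \<forall>n\<ge>N. \<exists>g\<in>tensors n. \<forall>\<eta>. \<bar>f \<eta> - g \<eta>\<bar> < e"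
proof -
  define R :: "((nat \<Rightarrow> 'g) \<Rightarrow> real) set"
    where "R = {h. continuous_on UNIV h \<and> (\<exists>N. \<forall>n\<ge>N. \<forall>\<eta>. h (trunc n \<eta>) = h \<eta>)}"
  have RI: "h \<in> R" if "continuous_on UNIV h" "\<And>n \<eta>. n \<ge> N \<Longrightarrow> h (trunc n \<eta>) = h \<eta>" for h N
    using that unfolding R_def by blast
  have RD: "\<exists>N. \<forall>n\<ge>N. \<forall>\<eta>. h (trunc n \<eta>) = h \<eta> \<and> h' (trunc n \<eta>) = h' \<eta>"
    if "h \<in> R" "h' \<in> R" for h h'
  proof -
    obtain N N' where "\<And>n \<eta>. n \<ge> N \<Longrightarrow> h (trunc n \<eta>) = h \<eta>" "\<And>n \<eta>. n \<ge> N' \<Longrightarrow> h' (trunc n \<eta>) = h' \<eta>"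
      using \<open>h \<in> R\<close> \<open>h' \<in> R\<close> unfolding R_def by blast
    then show ?thesis by (intro exI[of _ "max N N'"]) auto
  qed
  interpret function_ring_on R "UNIV :: (nat \<Rightarrow> 'g) set"
  proof
    show "compact (UNIV :: (nat \<Rightarrow> 'g) set)" by (rule compact_UNIV_fun[OF c])
    show "continuous_on UNIV h" if "h \<in> R" for h using that by (simp add: R_def)
    show "(\<lambda>_. r) \<in> R" for r by (rule RI) auto
    fix h h' assume h: "h \<in> R" "h' \<in> R"
    obtain N where N: "\<And>n \<eta>. n \<ge> N \<Longrightarrow> h (trunc n \<eta>) = h \<eta> \<and> h' (trunc n \<eta>) = h' \<eta>"
      using RD[OF h] by blast
    show "(\<lambda>x. h x + h' x) \<in> R" "(\<lambda>x. h x * h' x) \<in> R"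
      by (rule RI[of _ N]; use h N in \<open>auto simp: R_def intro!: continuous_intros\<close>)+
  next
    fix x y :: "nat \<Rightarrow> 'g" assume "x \<noteq> y"
    then obtain j where j: "x j \<noteq> y j" by auto
    obtain a :: "'g \<Rightarrow> real" where a: "continuous_on UNIV a" "a (x j) = 1" "a (y j) = 0"
      by (rule Urysohn_compact[OF c, of "{x j}" "{y j}"]) (use j in auto)
    have "(\<lambda>\<eta>. a (\<eta> j)) \<in> R"
      by (rule RI[of _ j]) (auto simp: trunc_def intro!: continuous_on_compose2[OF a(1)] continuous_intros)
    then show "\<exists>f\<in>R. f x \<noteq> f y" using a by (intro bexI[of _ "\<lambda>\<eta>. a (\<eta> j)"]) auto
  qed
  obtain h where h: "h \<in> R" "\<And>\<eta>. \<bar>f \<eta> - h \<eta>\<bar> < e / 2"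
    using Stone_Weierstrass_basic[OF f, of "e / 2"] e by auto
  obtain N where N: "\<And>n \<eta>. n \<ge> N \<Longrightarrow> h (trunc n \<eta>) = h \<eta>" "continuous_on UNIV h"
    using h(1) unfolding R_def by blast
  show ?thesis
  proof (intro exI[of _ N] allI impI)
    fix n assume "N \<le> n"
    then obtain g where g: "g \<in> tensors n" "\<And>\<eta>. \<bar>h \<eta> - g \<eta>\<bar> < e / 2"
      using tensors_dense[OF c N(2), of n "e / 2"] N(1) e by auto
    have "\<bar>f \<eta> - g \<eta>\<bar> < e" for \<eta>
      using h(2)[of \<eta>] g(2)[of \<eta>] by linarith
    then show "\<exists>g\<in>tensors n. \<forall>\<eta>. \<bar>f \<eta> - g \<eta>\<bar> < e" using g(1) by blast
  qed
qed

section \<open>Two solutions driven by a common noise\<close>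

lemma measurable_kernel_average:
  fixes P :: "(nat \<Rightarrow> 'g::{topological_group_add, t2_space}) measure"
  assumes P: "P \<in> solutions \<mu>" and c: "compact (UNIV :: 'g set)"
    and \<kappa>: "continuous_on UNIV (\<lambda>z :: 'g \<times> 'g. \<kappa> (fst z) (snd z) :: real)"
  shows "(\<lambda>x. \<integral>\<eta>. \<kappa> x (\<eta> n) \<partial>P) \<in> borel_measurable borel"
proof -
  interpret prob_space P by (rule solutionsD(2)[OF P])
  have "(\<lambda>\<eta>. \<eta> n) \<in> borel_measurable P"
    using past_measurable_imp_borel[OF measurable_coordinate_past[OF order_refl]] solutionsD(3)[OF P]
    by (simp cong: measurable_cong_sets)
  then have "(\<lambda>z. (fst z, snd z n)) \<in> measurable (borel \<Otimes>\<^sub>M P) (borel \<Otimes>\<^sub>M borel)"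
    by (intro measurable_Pair measurable_compose[OF measurable_snd]) auto
  from measurable_compose[OF this borel_measurable_pair_continuous[OF c c \<kappa>]]
  show ?thesis
    by (intro borel_measurable_lebesgue_integral) (simp add: case_prod_beta')
qed

lemma increment_translate: "increment k (\<lambda>j. z + \<eta> j) = increment k \<eta>"
  by (simp only: increment_def minus_add add.assoc minus_add_cancel)

text \<open>
  With \<open>\<omega>\<close> and \<open>\<eta>\<close> independent, the path \<open>\<omega> n - \<eta> n + \<eta>\<close> takes the value \<open>\<omega> n\<close> at time \<open>-n\<close> and
  then has the increments of \<open>\<eta>\<close>, which are independent of \<open>\<omega> n\<close> and \<open>\<eta> n\<close> and have the same
  laws as those of \<open>\<omega>\<close>.  It may therefore replace \<open>\<omega>\<close> inside \<open>g\<close>, also in the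
  presence of the weight \<open>\<phi> (\<omega> n - \<eta> n)\<close>.  Integrability of the inner integral is part of the
  induction because it is what allows the two integrals of a sum to be split.
\<close>

lemma tensor_common_noise:
  fixes P1 P2 :: "(nat \<Rightarrow> 'g::{topological_group_add, t2_space}) measure"
  assumes P: "P1 \<in> solutions \<mu>" "P2 \<in> solutions \<mu>" and c: "compact (UNIV :: 'g set)"
    and \<phi>: "continuous_on UNIV \<phi>" "\<And>x. 0 \<le> \<phi> x" "\<And>x. \<phi> x \<le> (1::real)"
    and g: "g \<in> tensors n"
  shows "integrable P1 (\<lambda>\<omega>. \<integral>\<eta>. \<phi> (\<omega> n - \<eta> n) * g (\<lambda>j. \<omega> n - \<eta> n + \<eta> j) \<partial>P2)
    \<and> (\<integral>\<omega>. (\<integral>\<eta>. \<phi> (\<omega> n - \<eta> n) \<partial>P2) * g \<omega> \<partial>P1)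
      = (\<integral>\<omega>. (\<integral>\<eta>. \<phi> (\<omega> n - \<eta> n) * g (\<lambda>j. \<omega> n - \<eta> n + \<eta> j) \<partial>P2) \<partial>P1)"
proof -
  interpret P1: prob_space P1 by (rule solutionsD(2)[OF P(1)])
  interpret P2: prob_space P2 by (rule solutionsD(2)[OF P(2)])
  define A where "A x = (\<integral>\<eta>. \<phi> (x - \<eta> n) \<partial>P2)" for x
  have \<phi>c: "continuous_on S (\<lambda>\<eta>. \<phi> (x - \<eta> n))" for x and S :: "(nat \<Rightarrow> 'g) set"
    by (intro continuous_on_compose2[OF \<phi>(1)] continuous_intros) auto
  have A: "A \<in> borel_measurable borel" unfolding A_def
    by (rule measurable_kernel_average[OF P(2) c])
      (auto intro!: continuous_on_compose2[OF \<phi>(1)] continuous_intros)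
  have "0 \<le> A x" "A x \<le> 1" for x
    unfolding A_def
    by (intro integral_unit_interval borel_measurable_integrable
        integrable_continuous_solution[OF P(2) c] \<phi>c \<phi> P2.prob_space_axioms)+
  then have Ab: "\<bar>A x\<bar> \<le> 1" for x by (simp add: abs_le_iff order_trans[of "- A x" 0])
  have coord: "(\<lambda>\<omega>. u (\<omega> n)) \<in> borel_measurable (past n)" if "u \<in> borel_measurable borel" for u :: "'g \<Rightarrow> real"
    by (rule measurable_compose[OF measurable_coordinate_past[OF order_refl] that])
  show ?thesis
    using g
  proof (induction rule: tensors.induct)
    case (prod a b)
    define \<beta> where "\<beta> = (\<Prod>k<n. \<integral>x. b k x \<partial>\<mu> k)"
    obtain C where C: "0 \<le> C" "\<And>x. \<bar>a x\<bar> \<le> C"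
      using bounded_continuous_compact[OF c prod(1)] by blast
    have aM: "a \<in> borel_measurable borel" by (rule borel_measurable_continuous_onI[OF prod(1)])
    have Aab: "\<bar>A x * a x\<bar> \<le> 1 * C" for x
      unfolding abs_mult using Ab[of x] C by (intro mult_mono) auto
    have "(\<integral>\<eta>. \<phi> (\<omega> n - \<eta> n) * (a (\<omega> n) *
        (\<Prod>k<n. b k (increment k (\<lambda>j. \<omega> n - \<eta> n + \<eta> j)))) \<partial>P2) = A (\<omega> n) * a (\<omega> n) * \<beta>" for \<omega>
    proof -
      have "(\<integral>\<eta>. \<phi> (\<omega> n - \<eta> n) * (a (\<omega> n) *
          (\<Prod>k<n. b k (increment k (\<lambda>j. \<omega> n - \<eta> n + \<eta> j)))) \<partial>P2)
        = (\<integral>\<eta>. a (\<omega> n) * (\<phi> (\<omega> n - \<eta> n) * (\<Prod>k<n. b k (increment k \<eta>))) \<partial>P2)"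
        by (simp add: increment_translate mult_ac)
      also have "\<dots> = a (\<omega> n) * (\<integral>\<eta>. \<phi> (\<omega> n - \<eta> n) * (\<Prod>k<n. b k (increment k \<eta>)) \<partial>P2)"
        by simp
      also have "(\<integral>\<eta>. \<phi> (\<omega> n - \<eta> n) * (\<Prod>k<n. b k (increment k \<eta>)) \<partial>P2) = A (\<omega> n) * \<beta>"
        unfolding A_def \<beta>_def
        by (rule solution_integral_prod[OF P(2) c prod(2), of _ _ 1])
          (use \<phi> in \<open>auto intro!: coord borel_measurable_continuous_onI continuous_on_compose2[OF \<phi>(1)]
             continuous_intros\<close>)
      finally show ?thesis by (simp add: mult_ac)
    qed
    note inner = this
    have "(\<lambda>\<omega>. A (\<omega> n) * a (\<omega> n)) \<in> borel_measurable (past n)"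
      using coord[of "\<lambda>x. A x * a x"] A aM by simp
    note Aa = this
    have Aai: "integrable P1 (\<lambda>\<omega>. A (\<omega> n) * a (\<omega> n))"
      using past_measurable_imp_borel[OF Aa] solutionsD(3)[OF P(1)] Aab
      by (intro P1.integrable_const_bound[of _ C]) (auto cong: measurable_cong_sets)
    have "(\<integral>\<omega>. A (\<omega> n) * (a (\<omega> n) * (\<Prod>k<n. b k (increment k \<omega>))) \<partial>P1)
        = (\<integral>\<omega>. A (\<omega> n) * a (\<omega> n) \<partial>P1) * \<beta>"
      using solution_integral_prod[OF P(1) c prod(2) Aa Aab] by (simp add: mult.assoc \<beta>_def)
    with Aai show ?case
      by (simp add: inner flip: A_def)
  next
    case (add f g)
    have i2: "integrable P2 (\<lambda>\<eta>. \<phi> (\<omega> n - \<eta> n) * h (\<lambda>j. \<omega> n - \<eta> n + \<eta> j))"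
      if "h \<in> tensors n" for h and \<omega> :: "nat \<Rightarrow> 'g"
      by (rule integrable_continuous_solution[OF P(2) c])
        (auto intro!: continuous_intros \<phi>c continuous_on_compose2[OF continuous_on_tensors[OF that]]
          continuous_on_coordinatewise_then_product)
    have i1: "integrable P1 (\<lambda>\<omega>. A (\<omega> n) * h \<omega>)" if "h \<in> tensors n" for h
    proof (rule Bochner_Integration.integrable_bound)
      show ih: "integrable P1 h"
        by (rule integrable_continuous_solution[OF P(1) c continuous_on_tensors[OF that]])
      show "(\<lambda>\<omega>. A (\<omega> n) * h \<omega>) \<in> borel_measurable P1"
        using past_measurable_imp_borel[OF coord[OF A]] solutionsD(3)[OF P(1)]
          borel_measurable_integrable[OF ih]
        by (intro borel_measurable_times) (simp_all cong: measurable_cong_sets)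
      show "AE \<omega> in P1. norm (A (\<omega> n) * h \<omega>) \<le> norm (h \<omega>)"
        using Ab by (auto simp: abs_mult intro!: mult_left_le_one_le)
    qed
    show ?case
      using add i2[OF add.hyps(1)] i2[OF add.hyps(2)] i1[OF add.hyps(1)] i1[OF add.hyps(2)]
      by (simp add: distrib_left flip: A_def)
  qed
qed

definition unit_functions :: "('g::topological_space \<Rightarrow> real) set" where
  "unit_functions = {\<phi>. continuous_on UNIV \<phi> \<and> (\<forall>x. 0 \<le> \<phi> x \<and> \<phi> x \<le> 1)}"

text \<open>
  The weight is a continuous function of the pair of paths, so the product \<open>\<sigma>\<close>-algebra sees it
  although it need not see the difference of the paths.
\<close>

lemma Fubini_kernel:
  fixes P1 P2 :: "(nat \<Rightarrow> 'g::{topological_group_add, t2_space}) measure"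
  assumes P: "P1 \<in> solutions \<mu>" "P2 \<in> solutions \<mu>" and c: "compact (UNIV :: 'g set)"
    and \<phi>: "\<phi> \<in> unit_functions" and f: "continuous_on UNIV (f :: _ \<Rightarrow> real)"
  shows "(\<integral>\<omega>. (\<integral>\<eta>. \<phi> (\<omega> n - \<eta> n) * f \<eta> \<partial>P2) \<partial>P1) = (\<integral>\<eta>. (\<integral>\<omega>. \<phi> (\<omega> n - \<eta> n) \<partial>P1) * f \<eta> \<partial>P2)"
    and "integrable P1 (\<lambda>\<omega>. \<integral>\<eta>. \<phi> (\<omega> n - \<eta> n) * f \<eta> \<partial>P2)"
    and "integrable (P1 \<Otimes>\<^sub>M P2) (\<lambda>(\<omega>, \<eta>). \<phi> (\<omega> n - \<eta> n) * f \<eta>)"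
proof -
  interpret P1: prob_space P1 by (rule solutionsD(2)[OF P(1)])
  interpret P2: prob_space P2 by (rule solutionsD(2)[OF P(2)])
  interpret pair_prob_space P1 P2 ..
  have \<phi>c: "continuous_on UNIV \<phi>" and \<phi>b: "\<bar>\<phi> x\<bar> \<le> 1" for x
    using \<phi> by (auto simp: unit_functions_def abs_le_iff intro: order_trans[of _ 0])
  obtain C where C: "0 \<le> C" "\<And>\<eta>. \<bar>f \<eta>\<bar> \<le> C"
    using bounded_continuous_compact[OF compact_UNIV_fun[OF c] f] by blast
  have "continuous_on UNIV (\<lambda>z :: (nat \<Rightarrow> 'g) \<times> (nat \<Rightarrow> 'g). \<phi> (fst z n - snd z n) * f (snd z))"
    by (intro continuous_intros continuous_on_compose2[OF \<phi>c] continuous_on_compose2[OF f]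
        continuous_on_compose2[OF continuous_on_product_coordinates]) auto
  from borel_measurable_pair_continuous[OF compact_UNIV_fun[OF c] compact_UNIV_fun[OF c] this]
  have "(\<lambda>z. \<phi> (fst z n - snd z n) * f (snd z)) \<in> borel_measurable (P1 \<Otimes>\<^sub>M P2)"
    using sets_pair_measure_cong[OF solutionsD(3)[OF P(1)] solutionsD(3)[OF P(2)]]
    by (simp cong: measurable_cong_sets)
  moreover have "\<bar>\<phi> x * f \<eta>\<bar> \<le> C" for x \<eta>
    using mult_mono[OF \<phi>b[of x] C(2)[of \<eta>]] by (simp add: abs_mult)
  ultimately show i: "integrable (P1 \<Otimes>\<^sub>M P2) (\<lambda>(\<omega>, \<eta>). \<phi> (\<omega> n - \<eta> n) * f \<eta>)"
    by (intro P.integrable_const_bound[of _ C]) (auto simp: case_prod_beta')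
  show "(\<integral>\<omega>. (\<integral>\<eta>. \<phi> (\<omega> n - \<eta> n) * f \<eta> \<partial>P2) \<partial>P1) = (\<integral>\<eta>. (\<integral>\<omega>. \<phi> (\<omega> n - \<eta> n) \<partial>P1) * f \<eta> \<partial>P2)"
    using Fubini_integral[OF i] by simp
  show "integrable P1 (\<lambda>\<omega>. \<integral>\<eta>. \<phi> (\<omega> n - \<eta> n) * f \<eta> \<partial>P2)"
    using integrable_fst'[OF i] by simp
qed

lemma difference_average:
  fixes P :: "(nat \<Rightarrow> 'g::{topological_group_add, t2_space}) measure"
  assumes P: "P \<in> solutions \<mu>" and c: "compact (UNIV :: 'g set)" and \<phi>: "\<phi> \<in> unit_functions"
  shows "(\<lambda>\<omega>. \<integral>\<eta>. \<phi> (\<omega> n - \<eta> n) \<partial>P) \<in> borel_measurable (past n)"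
    "(\<lambda>\<omega>. \<integral>\<eta>. \<phi> (\<eta> n - \<omega> n) \<partial>P) \<in> borel_measurable (past n)"
    "0 \<le> (\<integral>\<eta>. \<phi> (x - \<eta> n) \<partial>P)" "(\<integral>\<eta>. \<phi> (x - \<eta> n) \<partial>P) \<le> 1"
    "0 \<le> (\<integral>\<eta>. \<phi> (\<eta> n - x) \<partial>P)" "(\<integral>\<eta>. \<phi> (\<eta> n - x) \<partial>P) \<le> 1"
proof -
  have \<phi>c: "continuous_on UNIV \<phi>" and \<phi>b: "\<And>x. 0 \<le> \<phi> x" "\<And>x. \<phi> x \<le> 1"
    using \<phi> by (auto simp: unit_functions_def)
  show "(\<lambda>\<omega>. \<integral>\<eta>. \<phi> (\<omega> n - \<eta> n) \<partial>P) \<in> borel_measurable (past n)"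
    by (rule measurable_compose[OF measurable_coordinate_past[OF order_refl] measurable_kernel_average[OF P c]])
      (intro continuous_on_compose2[OF \<phi>c] continuous_intros, auto)
  show "(\<lambda>\<omega>. \<integral>\<eta>. \<phi> (\<eta> n - \<omega> n) \<partial>P) \<in> borel_measurable (past n)"
    by (rule measurable_compose[OF measurable_coordinate_past[OF order_refl]
          measurable_kernel_average[OF P c, of "\<lambda>x y. \<phi> (y - x)"]])
      (intro continuous_on_compose2[OF \<phi>c] continuous_intros, auto)
  have 1: "(\<lambda>\<eta>. \<phi> (x - \<eta> n)) \<in> borel_measurable P" and 2: "(\<lambda>\<eta>. \<phi> (\<eta> n - x)) \<in> borel_measurable P"
    by (intro borel_measurable_integrable integrable_continuous_solution[OF P c]
        continuous_on_compose2[OF \<phi>c] continuous_intros; simp)+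
  note p = solutionsD(2)[OF P]
  show "0 \<le> (\<integral>\<eta>. \<phi> (x - \<eta> n) \<partial>P)" "(\<integral>\<eta>. \<phi> (x - \<eta> n) \<partial>P) \<le> 1"
    by (intro integral_unit_interval[OF p 1] \<phi>b)+
  show "0 \<le> (\<integral>\<eta>. \<phi> (\<eta> n - x) \<partial>P)" "(\<integral>\<eta>. \<phi> (\<eta> n - x) \<partial>P) \<le> 1"
    by (intro integral_unit_interval[OF p 2] \<phi>b)+
qed

section \<open>The limit of the couplings\<close>

text \<open>
  The set function \<open>\<nu>\<close> meets the hypotheses of \<open>extremal_dominated\<close>: the weight \<open>h n\<close> depends on the
  past of time \<open>-n\<close> only, so it is independent of the increment at time \<open>-k\<close> once \<open>n > k\<close>, and
  \<open>F\<close> eventually leaves every \<open>k\<close> behind.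
\<close>

lemma one_sided_limit:
  fixes P :: "(nat \<Rightarrow> 'g::{topological_group_add, t2_space}) measure"
  assumes P: "P \<in> extremal (solutions \<mu>)" and \<mu>: "\<And>n. sets (\<mu> n) = sets borel"
    and F: "F \<noteq> bot" "F \<le> sequentially"
    and h: "\<And>n. h n \<in> borel_measurable (past n)" "\<And>n x. 0 \<le> h n x" "\<And>n x. h n x \<le> (1::real)"
    and lim: "\<And>B. B \<in> sets borel \<Longrightarrow> ((\<lambda>n. \<integral>x. h n x * indicator B x \<partial>P) \<longlongrightarrow> \<nu> B) F"
    and f: "integrable P f"
  shows "((\<lambda>n. \<integral>x. h n x * f x \<partial>P) \<longlongrightarrow> \<nu> UNIV * (\<integral>x. f x \<partial>P)) F"
proof -
  have Ps: "P \<in> solutions \<mu>" using P by (simp add: extremal_def)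
  note s = solutionsD[OF Ps]
  interpret prob_space P by (rule s(2))
  have hP: "h n \<in> borel_measurable P" for n
    using past_measurable_imp_borel[OF h(1)] s(3) by (simp cong: measurable_cong_sets)
  have i: "integrable P (\<lambda>x. h n x * indicator B x)" if "B \<in> sets borel" for n B
    using hP h that s(3)
    by (intro integrable_const_bound[of _ 1]) (auto split: split_indicator)
  have \<nu>: "\<nu> B = \<nu> UNIV * measure P B" if "B \<in> sets borel" for B
  proof (rule extremal_dominated[OF P \<mu>, of \<nu>])
    fix A :: "(nat \<Rightarrow> 'g) set" assume A: "A \<in> sets borel"
    show "0 \<le> \<nu> A"
      using h by (intro tendsto_lowerbound[OF lim[OF A] _ F(1)] always_eventually)
        (auto intro!: Bochner_Integration.integral_nonneg)
    have "(\<integral>x. h n x * indicator A x \<partial>P) \<le> (\<integral>x. indicator A x \<partial>P)" for n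
      using A s(3) h i[OF A, of n]
      by (intro integral_mono) (auto simp: emeasure_eq_measure split: split_indicator)
    then have "(\<integral>x. h n x * indicator A x \<partial>P) \<le> measure P A" for n
      using s(4) by simp
    then show "\<nu> A \<le> measure P A"
      by (intro tendsto_upperbound[OF lim[OF A] _ F(1)] always_eventually) auto
    fix B :: "(nat \<Rightarrow> 'g) set" assume B: "B \<in> sets borel" "A \<inter> B = {}"
    have "indicator (A \<union> B) x = (indicator A x + indicator B x :: real)" for x
      using B(2) by (auto split: split_indicator)
    then have eq: "(\<integral>x. h n x * indicator (A \<union> B) x \<partial>P)
        = (\<integral>x. h n x * indicator A x \<partial>P) + (\<integral>x. h n x * indicator B x \<partial>P)" for n
      using i[OF A, of n] i[OF B(1), of n] by (simp add: distrib_left)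
    show "\<nu> (A \<union> B) = \<nu> A + \<nu> B"
      using tendsto_unique[OF F(1) lim[OF sets.Un[OF A B(1)]]] tendsto_add[OF lim[OF A] lim[OF B(1)]]
      by (simp add: eq)
  next
    fix k and B :: "(nat \<Rightarrow> 'g) set" and C :: "'g set"
    assume B: "B \<in> sets (past (Suc k))" and C: "C \<in> sets borel"
    have bB: "B \<in> sets borel" using B sets_past_subset_borel by blast
    have bC: "increment k -` C \<inter> B \<in> sets borel"
      using measurable_sets[OF measurable_increment[of k] C] bB by auto
    have ev: "(\<integral>x. h n x * indicator (increment k -` C \<inter> B) x \<partial>P)
        = (\<integral>x. h n x * indicator B x \<partial>P) * measure (\<mu> k) C" if "Suc k \<le> n" for n
    proof -
      have "(\<integral>x. h n x * indicator (increment k -` C \<inter> B) x \<partial>P)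
          = (\<integral>x. (h n x * indicator B x) * indicator C (increment k x) \<partial>P)"
        by (rule Bochner_Integration.integral_cong) (auto split: split_indicator)
      also have "\<dots> = (\<integral>x. h n x * indicator B x \<partial>P) * (\<integral>y. indicator C y \<partial>\<mu> k)"
        by (rule solution_integral_step[OF Ps, of _ _ 1 _ 1])
          (use past_measurable_antimono[OF that h(1)] B C h in \<open>auto split: split_indicator\<close>)
      finally show ?thesis using sets_eq_imp_space_eq[OF \<mu>[of k]] by simp
    qed
    have "\<forall>\<^sub>F n in F. Suc k \<le> n"
      using F(2) eventually_ge_at_top[of "Suc k"] by (rule filter_leD)
    then have "\<forall>\<^sub>F n in F. (\<integral>x. h n x * indicator B x \<partial>P) * measure (\<mu> k) C
        = (\<integral>x. h n x * indicator (increment k -` C \<inter> B) x \<partial>P)"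
      by eventually_elim (simp add: ev)
    moreover have "((\<lambda>n. (\<integral>x. h n x * indicator B x \<partial>P) * measure (\<mu> k) C) \<longlongrightarrow> \<nu> B * measure (\<mu> k) C) F"
      by (intro tendsto_intros lim bB)
    ultimately have "((\<lambda>n. \<integral>x. h n x * indicator (increment k -` C \<inter> B) x \<partial>P) \<longlongrightarrow> \<nu> B * measure (\<mu> k) C) F"
      by (rule Lim_transform_eventually[rotated])
    from tendsto_unique[OF F(1) lim[OF bC] this]
    show "\<nu> (increment k -` C \<inter> B) = measure (\<mu> k) C * \<nu> B" by simp
  qed (rule that)
  show ?thesis
  proof (rule tendsto_integral_of_indicators[OF s(2) hP h(2,3) _ f])
    fix B assume "B \<in> sets P"
    then have B: "B \<in> sets borel" using s(3) by simp
    show "((\<lambda>n. \<integral>x. h n x * indicator B x \<partial>P) \<longlongrightarrow> \<nu> UNIV * measure P B) F"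
      using lim[OF B] unfolding \<nu>[OF B] .
  qed
qed

text \<open>
  Here \<open>l \<phi>\<close> is the limit of the expectation of \<open>\<phi> (\<omega> n - \<eta> n)\<close> for independent \<open>\<omega>\<close> and \<open>\<eta>\<close>.  It is the same
  constant for both solutions by Fubini's theorem, and that the limits factor as shown
  expresses that each path becomes independent of the difference.
\<close>

lemma coupling_limit:
  fixes P1 P2 :: "(nat \<Rightarrow> 'g::{topological_group_add, t2_space}) measure"
  assumes P: "P1 \<in> extremal (solutions \<mu>)" "P2 \<in> extremal (solutions \<mu>)"
    and \<mu>: "\<And>n. sets (\<mu> n) = sets borel" and c: "compact (UNIV :: 'g set)"
  obtains F l where "F \<noteq> bot" "F \<le> sequentially"
    "\<forall>\<phi>\<in>unit_functions. \<forall>f :: _ \<Rightarrow> real. continuous_on UNIV f \<longrightarrow>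
      ((\<lambda>n. \<integral>\<omega>. (\<integral>\<eta>. \<phi> (\<omega> n - \<eta> n) \<partial>P2) * f \<omega> \<partial>P1) \<longlongrightarrow> l \<phi> * (\<integral>\<omega>. f \<omega> \<partial>P1)) F"
    "\<forall>\<phi>\<in>unit_functions. \<forall>f :: _ \<Rightarrow> real. continuous_on UNIV f \<longrightarrow>
      ((\<lambda>n. \<integral>\<eta>. (\<integral>\<omega>. \<phi> (\<omega> n - \<eta> n) \<partial>P1) * f \<eta> \<partial>P2) \<longlongrightarrow> l \<phi> * (\<integral>\<eta>. f \<eta> \<partial>P2)) F"
proof -
  have Ps: "P1 \<in> solutions \<mu>" "P2 \<in> solutions \<mu>" using P by (auto simp: extremal_def)
  interpret P1: prob_space P1 by (rule solutionsD(2)[OF Ps(1)])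
  interpret P2: prob_space P2 by (rule solutionsD(2)[OF Ps(2)])
  define h1 where "h1 \<phi> n \<omega> = (\<integral>\<eta>. \<phi> (\<omega> n - \<eta> n) \<partial>P2)" for \<phi> :: "'g \<Rightarrow> real" and n and \<omega> :: "nat \<Rightarrow> 'g"
  define h2 where "h2 \<phi> n \<eta> = (\<integral>\<omega>. \<phi> (\<omega> n - \<eta> n) \<partial>P1)" for \<phi> :: "'g \<Rightarrow> real" and n and \<eta> :: "nat \<Rightarrow> 'g"
  have h: "h1 \<phi> n \<in> borel_measurable (past n)" "0 \<le> h1 \<phi> n x" "h1 \<phi> n x \<le> 1"
    "h2 \<phi> n \<in> borel_measurable (past n)" "0 \<le> h2 \<phi> n x" "h2 \<phi> n x \<le> 1" if "\<phi> \<in> unit_functions" for \<phi> n x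
    unfolding h1_def h2_def using difference_average[OF Ps(2) c that] difference_average[OF Ps(1) c that] by auto
  have b1: "0 \<le> (\<integral>x. h1 \<phi> n x * indicator B x \<partial>P1)" "(\<integral>x. h1 \<phi> n x * indicator B x \<partial>P1) \<le> 1"
    if "\<phi> \<in> unit_functions" "B \<in> sets borel" for \<phi> n B
    by (rule integral_unit_interval[OF P1.prob_space_axioms];
        use h[OF that(1)] past_measurable_imp_borel[OF h(1)[OF that(1)]] that(2) solutionsD(3)[OF Ps(1)] in
          \<open>auto split: split_indicator cong: measurable_cong_sets\<close>)+
  have b2: "0 \<le> (\<integral>x. h2 \<phi> n x * indicator B x \<partial>P2)" "(\<integral>x. h2 \<phi> n x * indicator B x \<partial>P2) \<le> 1"
    if "\<phi> \<in> unit_functions" "B \<in> sets borel" for \<phi> n B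
    by (rule integral_unit_interval[OF P2.prob_space_axioms];
        use h[OF that(1)] past_measurable_imp_borel[OF h(4)[OF that(1)]] that(2) solutionsD(3)[OF Ps(2)] in
          \<open>auto split: split_indicator cong: measurable_cong_sets\<close>)+
  (* One family indexed by weight, event and solution, so that a single filter serves all
     of them; the value 0 at other indices only keeps the family inside the unit interval. *)
  define a where "a = (\<lambda>(\<phi>, B, first) n. if \<phi> \<in> unit_functions \<and> B \<in> sets borel then
    (if first then \<integral>x. h1 \<phi> n x * indicator B x \<partial>P1 else \<integral>x. h2 \<phi> n x * indicator B x \<partial>P2) else 0)"
  have "0 \<le> a i n" "a i n \<le> 1" for i n
    using b1 b2 by (auto simp: a_def split: prod.splits)
  then obtain F L where F: "F \<noteq> bot" "F \<le> sequentially" "\<And>i. (a i \<longlongrightarrow> L i) F"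
    by (rule common_convergent_subfilter[of a]) blast
  have L1: "((\<lambda>n. \<integral>x. h1 \<phi> n x * indicator B x \<partial>P1) \<longlongrightarrow> L (\<phi>, B, True)) F"
    and L2: "((\<lambda>n. \<integral>x. h2 \<phi> n x * indicator B x \<partial>P2) \<longlongrightarrow> L (\<phi>, B, False)) F"
    if "\<phi> \<in> unit_functions" "B \<in> sets borel" for \<phi> B
    using F(3)[of "(\<phi>, B, True)"] F(3)[of "(\<phi>, B, False)"] that by (simp_all add: a_def)
  have LL: "L (\<phi>, UNIV, True) = L (\<phi>, UNIV, False)" if "\<phi> \<in> unit_functions" for \<phi>
  proof -
    have "(\<integral>x. h1 \<phi> n x \<partial>P1) = (\<integral>x. h2 \<phi> n x \<partial>P2)" for n
      using Fubini_kernel(1)[OF Ps c that, of "\<lambda>_. 1" n] by (simp add: h1_def h2_def)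
    then show ?thesis
      using tendsto_unique[OF F(1) L1[OF that, of UNIV] L2[OF that, of UNIV, THEN tendsto_cong[THEN iffD1, rotated]]]
      by simp
  qed
  show ?thesis
  proof (rule that[OF F(1,2), of "\<lambda>\<phi>. L (\<phi>, UNIV, True)"]; intro ballI allI impI)
    fix \<phi> :: "'g \<Rightarrow> real" and f :: "(nat \<Rightarrow> 'g) \<Rightarrow> real"
    assume \<phi>: "\<phi> \<in> unit_functions" and f: "continuous_on UNIV f"
    show "((\<lambda>n. \<integral>\<omega>. (\<integral>\<eta>. \<phi> (\<omega> n - \<eta> n) \<partial>P2) * f \<omega> \<partial>P1) \<longlongrightarrow> L (\<phi>, UNIV, True) * (\<integral>\<omega>. f \<omega> \<partial>P1)) F"
      unfolding h1_def[symmetric]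
      by (rule one_sided_limit[OF P(1) \<mu> F(1,2) _ _ _ L1[OF \<phi>] integrable_continuous_solution[OF Ps(1) c f]])
        (use h[OF \<phi>] in auto)
    show "((\<lambda>n. \<integral>\<eta>. (\<integral>\<omega>. \<phi> (\<omega> n - \<eta> n) \<partial>P1) * f \<eta> \<partial>P2) \<longlongrightarrow> L (\<phi>, UNIV, True) * (\<integral>\<eta>. f \<eta> \<partial>P2)) F"
      unfolding h2_def[symmetric] LL[OF \<phi>]
      by (rule one_sided_limit[OF P(2) \<mu> F(1,2) _ _ _ L2[OF \<phi>] integrable_continuous_solution[OF Ps(2) c f]])
        (use h[OF \<phi>] in auto)
  qed
qed

text \<open>
  A point of the support of the limit law of \<open>\<omega> n - \<eta> n\<close>.  If every point had a neighbourhood without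
  mass, finitely many Urysohn functions with zero limit would have a sum bounded below by
  \<open>1 / 2\<close> on the whole group.
\<close>

lemma charged_point_exists:
  fixes P1 P2 :: "(nat \<Rightarrow> 'g::{topological_group_add, t2_space}) measure"
  assumes P: "P1 \<in> solutions \<mu>" "P2 \<in> solutions \<mu>" and c: "compact (UNIV :: 'g set)"
    and F: "F \<noteq> bot"
    and lim: "\<And>\<phi>. \<phi> \<in> unit_functions \<Longrightarrow>
      ((\<lambda>n. \<integral>\<omega>. (\<integral>\<eta>. \<phi> (\<omega> n - \<eta> n) \<partial>P2) \<partial>P1) \<longlongrightarrow> l \<phi>) F"
  obtains z where "\<forall>U. open U \<longrightarrow> z \<in> U \<longrightarrow> (\<exists>\<phi>\<in>unit_functions. (\<forall>x. x \<notin> U \<longrightarrow> \<phi> x = 0) \<and> 0 < l \<phi>)"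
proof (rule ccontr)
  assume no: "\<not> thesis"
  have "\<exists>\<phi>. \<phi> \<in> unit_functions \<and> \<phi> z = 1 \<and> l \<phi> \<le> 0" for z
  proof -
    have "\<exists>U. open U \<and> z \<in> U \<and> (\<forall>\<phi>\<in>unit_functions. (\<forall>x. x \<notin> U \<longrightarrow> \<phi> x = 0) \<longrightarrow> \<not> 0 < l \<phi>)"
    proof (rule ccontr)
      assume "\<not> ?thesis"
      then have "\<forall>U. open U \<longrightarrow> z \<in> U \<longrightarrow> (\<exists>\<phi>\<in>unit_functions. (\<forall>x. x \<notin> U \<longrightarrow> \<phi> x = 0) \<and> 0 < l \<phi>)" by blast
      from that[OF this] no show False by simp
    qed
    then obtain U where U: "open U" "z \<in> U"
      "\<And>\<phi>. \<phi> \<in> unit_functions \<Longrightarrow> (\<forall>x. x \<notin> U \<longrightarrow> \<phi> x = 0) \<Longrightarrow> \<not> 0 < l \<phi>" by blast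
    obtain \<phi> :: "'g \<Rightarrow> real" where \<phi>: "continuous_on UNIV \<phi>" "\<And>x. 0 \<le> \<phi> x" "\<And>x. \<phi> x \<le> 1"
      "\<phi> z = 1" "\<And>x. x \<notin> U \<Longrightarrow> \<phi> x = 0"
      by (rule Urysohn_compact[OF c, of "{z}" "- U"]) (use U in auto)
    then have "\<phi> \<in> unit_functions" by (simp add: unit_functions_def)
    then show ?thesis using U(3)[of \<phi>] \<phi> by force
  qed
  then obtain \<Phi> where \<Phi>: "\<And>z. \<Phi> z \<in> unit_functions" "\<And>z. \<Phi> z z = 1" "\<And>z. l (\<Phi> z) \<le> 0" by metis
  have op: "open {x. 1 / 2 < \<Phi> z x}" for z
    using \<Phi>(1)[of z] open_vimage[of "{1/2<..}" "\<Phi> z"] by (auto simp: unit_functions_def vimage_def)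
  have "UNIV \<subseteq> (\<Union>z\<in>UNIV. {x. 1 / 2 < \<Phi> z x})" 
  proof
    fix x
    have "x \<in> {y. 1 / 2 < \<Phi> x y}" using \<Phi>(2)[of x] by simp
    then show "x \<in> (\<Union>z\<in>UNIV. {y. 1 / 2 < \<Phi> z y})" by blast
  qed
  then obtain D where D: "finite D" "UNIV \<subseteq> (\<Union>z\<in>D. {x. 1 / 2 < \<Phi> z x})"
    by (rule compactE_image[OF c op]) blast
  interpret P1: prob_space P1 by (rule solutionsD(2)[OF P(1)])
  interpret P2: prob_space P2 by (rule solutionsD(2)[OF P(2)])
  interpret pair_prob_space P1 P2 ..
  have i: "integrable (P1 \<Otimes>\<^sub>M P2) (\<lambda>p. \<Phi> z (fst p n - snd p n))" for z n
    using Fubini_kernel(3)[OF P c \<Phi>(1), of "\<lambda>_. 1" z n] by (simp add: case_prod_beta')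
  have eq: "(\<integral>\<omega>. (\<integral>\<eta>. \<Phi> z (\<omega> n - \<eta> n) \<partial>P2) \<partial>P1) = (\<integral>p. \<Phi> z (fst p n - snd p n) \<partial>(P1 \<Otimes>\<^sub>M P2))" for z n
    using integral_fst'[OF i[of z n]] by simp
  have "((\<lambda>n. \<Sum>z\<in>D. \<integral>\<omega>. (\<integral>\<eta>. \<Phi> z (\<omega> n - \<eta> n) \<partial>P2) \<partial>P1) \<longlongrightarrow> (\<Sum>z\<in>D. l (\<Phi> z))) F"
    by (intro tendsto_sum lim \<Phi>)
  moreover have "1 / 2 \<le> (\<Sum>z\<in>D. \<integral>\<omega>. (\<integral>\<eta>. \<Phi> z (\<omega> n - \<eta> n) \<partial>P2) \<partial>P1)" for n
  proof -
    have "1 / 2 \<le> (\<Sum>z\<in>D. \<Phi> z x)" for x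
    proof -
      obtain z where z: "z \<in> D" "1 / 2 < \<Phi> z x" using D(2) by blast
      have "\<Phi> z x \<le> (\<Sum>z\<in>D. \<Phi> z x)"
        using \<Phi>(1) z D(1) by (intro member_le_sum) (auto simp: unit_functions_def)
      then show ?thesis using z by linarith
    qed
    then have "1 / 2 \<le> (\<integral>p. (\<Sum>z\<in>D. \<Phi> z (fst p n - snd p n)) \<partial>(P1 \<Otimes>\<^sub>M P2))"
      by (intro P.integral_ge_const Bochner_Integration.integrable_sum i AE_I2)
    also have "\<dots> = (\<Sum>z\<in>D. \<integral>\<omega>. (\<integral>\<eta>. \<Phi> z (\<omega> n - \<eta> n) \<partial>P2) \<partial>P1)"
      unfolding eq by (rule Bochner_Integration.integral_sum) (rule i)
    finally show ?thesis .
  qed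
  ultimately have "1 / 2 \<le> (\<Sum>z\<in>D. l (\<Phi> z))"
    by (intro tendsto_lowerbound[OF _ always_eventually F]) auto
  also have "\<dots> \<le> 0" using \<Phi>(3) by (simp add: sum_nonpos)
  finally show False by simp
qed

text \<open>
  The tube lemma, applied to the compact path space.
\<close>

lemma uniform_translate:
  fixes f :: "(nat \<Rightarrow> 'g::{topological_group_add, t2_space}) \<Rightarrow> real"
  assumes c: "compact (UNIV :: 'g set)" and f: "continuous_on UNIV f" and e: "0 < e"
  obtains U where "open U" "z \<in> U" "\<forall>w\<in>U. \<forall>\<eta>. \<bar>f (\<lambda>j. w + \<eta> j) - f (\<lambda>j. z + \<eta> j)\<bar> < e"
proof -
  have "continuous_on UNIV (\<lambda>p :: 'g \<times> (nat \<Rightarrow> 'g). snd p j)" for j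
    by (rule continuous_on_product_then_coordinatewise[OF continuous_on_snd[OF continuous_on_id]])
  then have t: "continuous_on UNIV (\<lambda>p :: 'g \<times> (nat \<Rightarrow> 'g). (\<lambda>j. fst p + snd p j))"
    and t': "continuous_on UNIV (\<lambda>p :: 'g \<times> (nat \<Rightarrow> 'g). (\<lambda>j. z + snd p j))"
    by (intro continuous_on_coordinatewise_then_product continuous_on_add continuous_on_const
        continuous_on_fst continuous_on_id; simp)+
  have ft: "continuous_on UNIV (\<lambda>p :: 'g \<times> (nat \<Rightarrow> 'g). f (\<lambda>j. fst p + snd p j))"
    by (rule continuous_on_compose2[OF f t]) simp
  have ft': "continuous_on UNIV (\<lambda>p :: 'g \<times> (nat \<Rightarrow> 'g). f (\<lambda>j. z + snd p j))"
    by (rule continuous_on_compose2[OF f t']) simp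
  define W where "W = {p :: 'g \<times> (nat \<Rightarrow> 'g). \<bar>f (\<lambda>j. fst p + snd p j) - f (\<lambda>j. z + snd p j)\<bar> < e}"
  have "open W" unfolding W_def
    by (rule open_Collect_less) (intro continuous_intros ft ft')+
  moreover have "{z} \<times> UNIV \<subseteq> W" using e by (auto simp: W_def)
  ultimately have "\<exists>U. z \<in> U \<and> open U \<and> U \<times> UNIV \<subseteq> W"
    by (rule Elementary_Topology.tube_lemma[OF compact_UNIV_fun[OF c]])
  then obtain U where U: "z \<in> U" "open U" "U \<times> UNIV \<subseteq> W" by blast
  have "\<bar>f (\<lambda>j. w + \<eta> j) - f (\<lambda>j. z + \<eta> j)\<bar> < e" if "w \<in> U" for w \<eta>
  proof -
    have "(w, \<eta>) \<in> W" using U(3) that by blast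
    then show ?thesis by (simp add: W_def)
  qed
  with U(1,2) show ?thesis by (intro that[of U] ballI allI)
qed

text \<open>
  One \<open>e\<close> pays for replacing \<open>f\<close> by \<open>g\<close> in the first integral, one for returning from \<open>g\<close> to \<open>f\<close> after
  \<open>\<omega>\<close> has been exchanged for \<open>\<omega> n - \<eta> n + \<eta>\<close>, and one for moving the translation \<open>\<omega> n - \<eta> n\<close> to \<open>z\<close>,
  which is permitted wherever \<open>\<phi>\<close> does not vanish.
\<close>

lemma coupled_integrals_close:
  fixes P1 P2 :: "(nat \<Rightarrow> 'g::{topological_group_add, t2_space}) measure"
  assumes P: "P1 \<in> solutions \<mu>" "P2 \<in> solutions \<mu>" and c: "compact (UNIV :: 'g set)"
    and \<phi>: "\<phi> \<in> unit_functions" and f: "continuous_on UNIV f"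
    and g: "g \<in> tensors n" "\<And>\<eta>. \<bar>f \<eta> - g \<eta>\<bar> < e"
    and U: "\<And>x. x \<notin> U \<Longrightarrow> \<phi> x = 0"
      "\<And>w \<eta>. w \<in> U \<Longrightarrow> \<bar>f (\<lambda>j. w + \<eta> j) - f (\<lambda>j. z + \<eta> j)\<bar> < e"
  shows "\<bar>(\<integral>\<omega>. (\<integral>\<eta>. \<phi> (\<omega> n - \<eta> n) \<partial>P2) * f \<omega> \<partial>P1)
      - (\<integral>\<eta>. (\<integral>\<omega>. \<phi> (\<omega> n - \<eta> n) \<partial>P1) * f (\<lambda>j. z + \<eta> j) \<partial>P2)\<bar>
    \<le> 3 * e * (\<integral>\<omega>. (\<integral>\<eta>. \<phi> (\<omega> n - \<eta> n) \<partial>P2) \<partial>P1)"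
proof -
  interpret P1: prob_space P1 by (rule solutionsD(2)[OF P(1)])
  interpret P2: prob_space P2 by (rule solutionsD(2)[OF P(2)])
  have \<phi>c: "continuous_on UNIV \<phi>" and \<phi>b: "\<And>x. 0 \<le> \<phi> x" "\<And>x. \<phi> x \<le> 1"
    using \<phi> by (auto simp: unit_functions_def)
  have gc: "continuous_on UNIV g" by (rule continuous_on_tensors[OF g(1)])
  define h where "h \<omega> = (\<integral>\<eta>. \<phi> (\<omega> n - \<eta> n) \<partial>P2)" for \<omega> :: "nat \<Rightarrow> 'g"
  define J where "J \<omega> = (\<integral>\<eta>. \<phi> (\<omega> n - \<eta> n) * g (\<lambda>j. \<omega> n - \<eta> n + \<eta> j) \<partial>P2)" for \<omega> :: "nat \<Rightarrow> 'g"
  define K where "K \<omega> = (\<integral>\<eta>. \<phi> (\<omega> n - \<eta> n) * f (\<lambda>j. z + \<eta> j) \<partial>P2)" for \<omega> :: "nat \<Rightarrow> 'g"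
  have fz: "continuous_on UNIV (\<lambda>\<eta>. f (\<lambda>j. z + \<eta> j))"
    by (intro continuous_on_compose2[OF f] continuous_on_coordinatewise_then_product continuous_intros) auto
  have J: "integrable P1 J" "(\<integral>\<omega>. h \<omega> * g \<omega> \<partial>P1) = (\<integral>\<omega>. J \<omega> \<partial>P1)"
    using tensor_common_noise[OF P c \<phi>c \<phi>b g(1)] by (auto simp: h_def J_def[abs_def])
  have K: "integrable P1 K"
    "(\<integral>\<omega>. K \<omega> \<partial>P1) = (\<integral>\<eta>. (\<integral>\<omega>. \<phi> (\<omega> n - \<eta> n) \<partial>P1) * f (\<lambda>j. z + \<eta> j) \<partial>P2)"
    using Fubini_kernel[OF P c \<phi> fz, of n] by (auto simp: K_def[abs_def])
  have h: "integrable P1 h"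
    using Fubini_kernel(2)[OF P c \<phi>, of "\<lambda>_. 1" n] by (simp add: h_def[abs_def])
  have h0: "0 \<le> h \<omega>" for \<omega>
    unfolding h_def by (rule difference_average(3)[OF P(2) c \<phi>])
  have hm: "integrable P1 (\<lambda>\<omega>. h \<omega> * u \<omega>)" if u: "continuous_on UNIV (u :: _ \<Rightarrow> real)" for u
  proof (rule Bochner_Integration.integrable_bound)
    show iu: "integrable P1 u" by (rule integrable_continuous_solution[OF P(1) c u])
    show "(\<lambda>\<omega>. h \<omega> * u \<omega>) \<in> borel_measurable P1" using h iu by auto
    show "AE \<omega> in P1. norm (h \<omega> * u \<omega>) \<le> norm (u \<omega>)"
      using h0 difference_average(4)[OF P(2) c \<phi>] by (auto simp: abs_mult h_def intro!: mult_left_le_one_le)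
  qed
  have "\<bar>(\<integral>\<omega>. h \<omega> * f \<omega> \<partial>P1) - (\<integral>\<omega>. h \<omega> * g \<omega> \<partial>P1)\<bar> = \<bar>\<integral>\<omega>. h \<omega> * (f \<omega> - g \<omega>) \<partial>P1\<bar>"
    using hm[OF f] hm[OF gc] by (simp add: right_diff_distrib)
  also have "\<dots> \<le> (\<integral>\<omega>. \<bar>h \<omega> * (f \<omega> - g \<omega>)\<bar> \<partial>P1)" by (rule integral_abs_bound)
  also have "\<dots> \<le> (\<integral>\<omega>. h \<omega> * e \<partial>P1)"
    using h0 less_imp_le[OF g(2)] h
    by (intro integral_mono integrable_abs hm continuous_intros f gc)
      (auto simp: abs_mult intro!: mult_left_mono)
  finally have 1: "\<bar>(\<integral>\<omega>. h \<omega> * f \<omega> \<partial>P1) - (\<integral>\<omega>. h \<omega> * g \<omega> \<partial>P1)\<bar> \<le> (\<integral>\<omega>. h \<omega> \<partial>P1) * e"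
    by simp
  have JK: "\<bar>J \<omega> - K \<omega>\<bar> \<le> 2 * e * h \<omega>" for \<omega>
  proof -
    have p: "\<bar>\<phi> (\<omega> n - \<eta> n) * g (\<lambda>j. \<omega> n - \<eta> n + \<eta> j) - \<phi> (\<omega> n - \<eta> n) * f (\<lambda>j. z + \<eta> j)\<bar>
        \<le> \<phi> (\<omega> n - \<eta> n) * (2 * e)" for \<eta>
    proof (cases "\<omega> n - \<eta> n \<in> U")
      case True
      have "\<bar>g (\<lambda>j. \<omega> n - \<eta> n + \<eta> j) - f (\<lambda>j. z + \<eta> j)\<bar> \<le> 2 * e"
        using g(2)[of "\<lambda>j. \<omega> n - \<eta> n + \<eta> j"] U(2)[OF True, of \<eta>] by linarith
      then have "\<phi> (\<omega> n - \<eta> n) * \<bar>g (\<lambda>j. \<omega> n - \<eta> n + \<eta> j) - f (\<lambda>j. z + \<eta> j)\<bar>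
          \<le> \<phi> (\<omega> n - \<eta> n) * (2 * e)"
        using \<phi>b(1) by (intro mult_left_mono) auto
      then show ?thesis using \<phi>b(1) by (simp add: abs_mult flip: right_diff_distrib)
    qed (simp add: U(1))
    have c1: "continuous_on UNIV (\<lambda>\<eta>. \<phi> (\<omega> n - \<eta> n))"
      by (intro continuous_on_compose2[OF \<phi>c] continuous_intros) auto
    have c2: "continuous_on UNIV (\<lambda>\<eta>. g (\<lambda>j. \<omega> n - \<eta> n + \<eta> j))"
      by (intro continuous_on_compose2[OF gc] continuous_on_coordinatewise_then_product continuous_intros) auto
    note i = integrable_continuous_solution[OF P(2) c]
    have "\<bar>J \<omega> - K \<omega>\<bar> = \<bar>\<integral>\<eta>. \<phi> (\<omega> n - \<eta> n) * g (\<lambda>j. \<omega> n - \<eta> n + \<eta> j)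
        - \<phi> (\<omega> n - \<eta> n) * f (\<lambda>j. z + \<eta> j) \<partial>P2\<bar>"
      unfolding J_def K_def
      by (subst Bochner_Integration.integral_diff) (auto intro!: i continuous_on_mult c1 c2 fz)
    also have "\<dots> \<le> (\<integral>\<eta>. \<bar>\<phi> (\<omega> n - \<eta> n) * g (\<lambda>j. \<omega> n - \<eta> n + \<eta> j)
        - \<phi> (\<omega> n - \<eta> n) * f (\<lambda>j. z + \<eta> j)\<bar> \<partial>P2)"
      by (rule integral_abs_bound)
    also have "\<dots> \<le> (\<integral>\<eta>. \<phi> (\<omega> n - \<eta> n) * (2 * e) \<partial>P2)"
      by (intro integral_mono p i continuous_intros continuous_on_mult c1 c2 fz)
    also have "\<dots> = 2 * e * h \<omega>" by (simp add: h_def)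
    finally show ?thesis .
  qed
  have "\<bar>(\<integral>\<omega>. J \<omega> \<partial>P1) - (\<integral>\<omega>. K \<omega> \<partial>P1)\<bar> = \<bar>\<integral>\<omega>. J \<omega> - K \<omega> \<partial>P1\<bar>"
    using J K by simp
  also have "\<dots> \<le> (\<integral>\<omega>. \<bar>J \<omega> - K \<omega>\<bar> \<partial>P1)" by (rule integral_abs_bound)
  also have "\<dots> \<le> (\<integral>\<omega>. 2 * e * h \<omega> \<partial>P1)"
    using J K h by (intro integral_mono JK) auto
  also have "\<dots> = 2 * e * (\<integral>\<omega>. h \<omega> \<partial>P1)" by simp
  finally have "\<bar>(\<integral>\<omega>. h \<omega> * f \<omega> \<partial>P1) - (\<integral>\<omega>. K \<omega> \<partial>P1)\<bar> \<le> 3 * e * (\<integral>\<omega>. h \<omega> \<partial>P1)"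
    using 1 J(2) by (simp add: algebra_simps abs_le_iff)
  then show ?thesis unfolding K(2) h_def .
qed

section \<open>Transitivity\<close>

theorem theorem1p3:
  fixes \<mu> :: "nat \<Rightarrow> 'g::{topological_group_add, t2_space} measure"
    and P1 P2 :: "(nat \<Rightarrow> 'g) measure"
  assumes "compact (UNIV :: 'g set)"
    and "\<And>n. prob_space (\<mu> n)"
    and "\<And>n. sets (\<mu> n) = sets borel"
    and "P1 \<in> extremal (solutions \<mu>)"
    and "P2 \<in> extremal (solutions \<mu>)"
  shows "\<exists>g. P1 = translate g P2"
proof -
  note c = assms(1)
  have P: "P1 \<in> solutions \<mu>" "P2 \<in> solutions \<mu>" using assms(4,5) by (auto simp: extremal_def)
  obtain F l where F: "F \<noteq> bot" "F \<le> sequentially" and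
    lim1: "\<forall>\<phi>\<in>unit_functions. \<forall>f :: _ \<Rightarrow> real. continuous_on UNIV f \<longrightarrow>
      ((\<lambda>n. \<integral>\<omega>. (\<integral>\<eta>. \<phi> (\<omega> n - \<eta> n) \<partial>P2) * f \<omega> \<partial>P1) \<longlongrightarrow> l \<phi> * (\<integral>\<omega>. f \<omega> \<partial>P1)) F" and
    lim2: "\<forall>\<phi>\<in>unit_functions. \<forall>f :: _ \<Rightarrow> real. continuous_on UNIV f \<longrightarrow>
      ((\<lambda>n. \<integral>\<eta>. (\<integral>\<omega>. \<phi> (\<omega> n - \<eta> n) \<partial>P1) * f \<eta> \<partial>P2) \<longlongrightarrow> l \<phi> * (\<integral>\<eta>. f \<eta> \<partial>P2)) F"
    by (rule coupling_limit[OF assms(4,5,3) c]) (rule that)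
  interpret P1: prob_space P1 by (rule solutionsD(2)[OF P(1)])
  have lim0: "((\<lambda>n. \<integral>\<omega>. (\<integral>\<eta>. \<phi> (\<omega> n - \<eta> n) \<partial>P2) \<partial>P1) \<longlongrightarrow> l \<phi>) F" if "\<phi> \<in> unit_functions" for \<phi>
    using lim1[rule_format, OF that continuous_on_const[of UNIV 1]] P1.prob_space by simp
  obtain z where z: "\<forall>U. open U \<longrightarrow> z \<in> U \<longrightarrow> (\<exists>\<phi>\<in>unit_functions. (\<forall>x. x \<notin> U \<longrightarrow> \<phi> x = 0) \<and> 0 < l \<phi>)"
    by (rule charged_point_exists[OF P c F(1) lim0])
  have T: "continuous_on UNIV (\<lambda>\<eta> :: nat \<Rightarrow> 'g. \<lambda>n. z + \<eta> n)"
    by (intro continuous_on_coordinatewise_then_product continuous_intros)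
  have "P1 = translate z P2"
  proof (rule radon_prob_eqI[OF compact_UNIV_fun[OF c] solutionsD(1)[OF P(1)]])
    show "radon_prob (translate z P2)"
      unfolding translate_def by (rule radon_prob_distr[OF solutionsD(1)[OF P(2)] T])
    fix f :: "(nat \<Rightarrow> 'g) \<Rightarrow> real" assume f: "continuous_on UNIV f"
    have fz: "continuous_on UNIV (\<lambda>\<eta>. f (\<lambda>j. z + \<eta> j))"
      by (rule continuous_on_compose2[OF f T]) simp
    have "\<bar>(\<integral>\<omega>. f \<omega> \<partial>P1) - (\<integral>\<eta>. f (\<lambda>j. z + \<eta> j) \<partial>P2)\<bar> \<le> 3 * e" if e: "0 < e" for e
    proof -
      obtain U where U: "open U" "z \<in> U" "\<forall>w\<in>U. \<forall>\<eta>. \<bar>f (\<lambda>j. w + \<eta> j) - f (\<lambda>j. z + \<eta> j)\<bar> < e"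
        by (rule uniform_translate[OF c f e, of z]) (rule that)
      obtain \<phi> where \<phi>: "\<phi> \<in> unit_functions" "\<And>x. x \<notin> U \<Longrightarrow> \<phi> x = 0" "0 < l \<phi>"
        using z U(1,2) by blast
      obtain N where N: "\<And>n. N \<le> n \<Longrightarrow> \<exists>g\<in>tensors n. \<forall>\<eta>. \<bar>f \<eta> - g \<eta>\<bar> < e"
        using tensors_eventually_dense[OF c f e] by blast
      have ev: "\<forall>\<^sub>F n in F. \<bar>(\<integral>\<omega>. (\<integral>\<eta>. \<phi> (\<omega> n - \<eta> n) \<partial>P2) * f \<omega> \<partial>P1)
          - (\<integral>\<eta>. (\<integral>\<omega>. \<phi> (\<omega> n - \<eta> n) \<partial>P1) * f (\<lambda>j. z + \<eta> j) \<partial>P2)\<bar>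
        \<le> 3 * e * (\<integral>\<omega>. (\<integral>\<eta>. \<phi> (\<omega> n - \<eta> n) \<partial>P2) \<partial>P1)"
        using filter_leD[OF F(2) eventually_ge_at_top[of N]]
      proof eventually_elim
        case (elim n)
        then obtain g where "g \<in> tensors n" "\<And>\<eta>. \<bar>f \<eta> - g \<eta>\<bar> < e" using N by blast
        then show ?case by (rule coupled_integrals_close[OF P c \<phi>(1) f _ _ \<phi>(2) U(3)[rule_format]])
      qed
      have "\<bar>l \<phi> * (\<integral>\<omega>. f \<omega> \<partial>P1) - l \<phi> * (\<integral>\<eta>. f (\<lambda>j. z + \<eta> j) \<partial>P2)\<bar> \<le> 3 * e * l \<phi>"
        by (rule tendsto_le[OF F(1) _ _ ev])
          (intro tendsto_intros lim0 lim1[rule_format] lim2[rule_format] \<phi>(1) f fz)+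
      then have "l \<phi> * \<bar>(\<integral>\<omega>. f \<omega> \<partial>P1) - (\<integral>\<eta>. f (\<lambda>j. z + \<eta> j) \<partial>P2)\<bar> \<le> l \<phi> * (3 * e)"
        using \<phi>(3) by (simp add: abs_mult mult_ac flip: right_diff_distrib)
      then show ?thesis using \<phi>(3) by simp
    qed
    note close = this
    have "\<bar>(\<integral>\<omega>. f \<omega> \<partial>P1) - (\<integral>\<eta>. f (\<lambda>j. z + \<eta> j) \<partial>P2)\<bar> \<le> 0"
    proof (rule field_le_epsilon)
      fix e :: real assume "0 < e"
      then show "\<bar>(\<integral>\<omega>. f \<omega> \<partial>P1) - (\<integral>\<eta>. f (\<lambda>j. z + \<eta> j) \<partial>P2)\<bar> \<le> 0 + e"
        using close[of "e / 3"] by simp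
    qed
    moreover have "integral\<^sup>L (translate z P2) f = (\<integral>\<eta>. f (\<lambda>j. z + \<eta> j) \<partial>P2)"
      unfolding translate_def
      using borel_measurable_continuous_onI[OF T] solutionsD(3)[OF P(2)]
      by (intro integral_distr borel_measurable_continuous_onI[OF f]) (simp cong: measurable_cong_sets)
    ultimately show "integral\<^sup>L P1 f = integral\<^sup>L (translate z P2) f" by simp
  qed
  then show ?thesis by blast
qed

end
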